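(* Let $k\ge 0$, let $\Omega=[0,L_x]\times[0,L_y]$ with $L_x,L_y>0$, let $V\in L^\infty(\Omega)$, and let $g$ be a smooth compactly supported $\mathbb{C}^2$-valued function on $(0,L_y)$. Then the initial--boundary value problem $$\begin{cases}-\mathrm{i}\,\partial_x\psi+\mathrm{i}\,\alpha\,\partial_y\psi+k\,[\beta+V(x,y)]\,\psi=0 & \text{in }\Omega,\\ \psi_2(x,0)=0,\quad \psi_1(x,L_y)=0 & \text{for }0\le x\le L_x,\\ \psi(0,y)=g(y) & \text{for }0\le y\le L_y,\end{cases}$$ for $\psi=(\psi_1,\psi_2)^{T}$ admits a unique solution $\psi\in C([0,L_x];L^2(0,L_y;\mathbb{C}^2))$ satisfying the integral equation $$\psi(x)=T(x)g+\int_0^x T(x-x')B(x')\psi(x')\,dx',\qquad 0\le x\le L_x .$$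
   Context: $\alpha=\begin{pmatrix}0&1\\1&0\end{pmatrix}$ and $\beta=\begin{pmatrix}1&0\\0&-1\end{pmatrix}$. $V$ is a scalar function. The variable $x$ is time-like. The equation is rewritten as the evolution equation $\partial_x\psi=A\psi+B(x)\psi$, where $A=\alpha\,\partial_y-\mathrm{i}k\beta$ is the operator on $L^2(0,L_y;\mathbb{C}^2)$ with domain $$D(A)=\{\psi\in H^1(0,L_y;\mathbb{C}^2):\ \psi_2(0)=0,\ \psi_1(L_y)=0\},$$ and $B(x)$ is multiplication by $-\mathrm{i}k\,V(x,\cdot)$. The operator $A$ is skew-adjoint, and $\{T(x)\}_{x\ge0}$ denotes the strongly continuous semigroup it generates on $L^2(0,L_y;\mathbb{C}^2)$; it satisfies $\|T(x)\|_{L^2\to L^2}=1$ and $T(x+x')=T(x)T(x')$. "Solution" means mild solution, i.e. a function in $C([0,L_x];L^2(0,L_y;\mathbb{C}^2))$ satisfying the displayed integral equation. *)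

theory Defs
  imports "HOL-Analysis.Analysis"
begin

section \<open>The space of square-integrable spinor fields on the line\<close>

definition square_integrable :: "(real \<Rightarrow> complex^2) \<Rightarrow> bool"
  where "square_integrable f \<longleftrightarrow>
    f \<in> borel_measurable lebesgue \<and> integrable lebesgue (\<lambda>y. (norm (f y))\<^sup>2)"

definition L2_rel :: "(real \<Rightarrow> complex^2) \<Rightarrow> (real \<Rightarrow> complex^2) \<Rightarrow> bool"
  where "L2_rel f g \<longleftrightarrow>
    square_integrable f \<and> square_integrable g \<and> (AE y in lebesgue. f y = g y)"

lemma square_integrable_0 [simp]: "square_integrable (\<lambda>y. 0)"
  by (simp add: square_integrable_def)

lemma square_integrable_measurable [measurable_dest]:
  "square_integrable f \<Longrightarrow> f \<in> borel_measurable lebesgue"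
  by (simp add: square_integrable_def)

lemma square_integrable_inner:
  assumes "square_integrable f" "square_integrable g"
  shows "integrable lebesgue (\<lambda>y. f y \<bullet> g y)"
proof (rule Bochner_Integration.integrable_bound)
  show "integrable lebesgue (\<lambda>y. (norm (f y))\<^sup>2 + (norm (g y))\<^sup>2)"
    using assms by (auto simp: square_integrable_def)
  show "(\<lambda>y. f y \<bullet> g y) \<in> borel_measurable lebesgue"
    using assms by (auto simp: square_integrable_def)
  show "AE y in lebesgue. norm (f y \<bullet> g y) \<le> norm ((norm (f y))\<^sup>2 + (norm (g y))\<^sup>2)"
  proof (rule AE_I2)
    fix y
    have "\<bar>f y \<bullet> g y\<bar> \<le> norm (f y) * norm (g y)" by (rule Cauchy_Schwarz_ineq2)
    moreover have "2 * (norm (f y) * norm (g y)) \<le> (norm (f y))\<^sup>2 + (norm (g y))\<^sup>2"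
      using sum_squares_bound[of "norm (f y)" "norm (g y)"] by simp
    moreover have "0 \<le> norm (f y) * norm (g y)" by simp
    ultimately show "norm (f y \<bullet> g y) \<le> norm ((norm (f y))\<^sup>2 + (norm (g y))\<^sup>2)" by simp
  qed
qed

lemma square_integrable_add:
  assumes "square_integrable f" "square_integrable g"
  shows "square_integrable (\<lambda>y. f y + g y)"
  unfolding square_integrable_def
proof
  show "(\<lambda>y. f y + g y) \<in> borel_measurable lebesgue"
    using assms by (auto simp: square_integrable_def)
  have "integrable lebesgue (\<lambda>y. (norm (f y))\<^sup>2 + (norm (g y))\<^sup>2 + 2 * (f y \<bullet> g y))"
    using assms square_integrable_inner[OF assms] by (auto simp: square_integrable_def)
  then show "integrable lebesgue (\<lambda>y. (norm (f y + g y))\<^sup>2)"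
    by (simp add: power2_norm_eq_inner inner_add inner_commute algebra_simps)
qed

lemma square_integrable_scaleR:
  "square_integrable f \<Longrightarrow> square_integrable (\<lambda>y. c *\<^sub>R f y)"
  by (auto simp: square_integrable_def power_mult_distrib)

lemma square_integrable_uminus:
  "square_integrable f \<Longrightarrow> square_integrable (\<lambda>y. - f y)"
  using square_integrable_scaleR[of f "-1"] by simp

lemma square_integrable_diff:
  "square_integrable f \<Longrightarrow> square_integrable g \<Longrightarrow> square_integrable (\<lambda>y. f y - g y)"
  using square_integrable_add[of f "\<lambda>y. - g y"] square_integrable_uminus[of g] by simp

quotient_type L2 = "real \<Rightarrow> complex^2" / partial: L2_rel
proof (rule part_equivpI)
  show "\<exists>f. L2_rel f f" by (auto simp: L2_rel_def intro!: exI[of _ "\<lambda>y. 0"])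
  show "symp L2_rel" by (auto simp: symp_def L2_rel_def)
  show "transp L2_rel" by (auto simp: transp_def L2_rel_def)
qed

instantiation L2 :: real_inner
begin

lift_definition zero_L2 :: L2 is "\<lambda>y. 0" by (simp add: L2_rel_def)

lift_definition plus_L2 :: "L2 \<Rightarrow> L2 \<Rightarrow> L2" is "\<lambda>f g y. f y + g y"
  by (auto simp: L2_rel_def intro: square_integrable_add)

lift_definition minus_L2 :: "L2 \<Rightarrow> L2 \<Rightarrow> L2" is "\<lambda>f g y. f y - g y"
  by (auto simp: L2_rel_def intro: square_integrable_diff)

lift_definition uminus_L2 :: "L2 \<Rightarrow> L2" is "\<lambda>f y. - f y"
  by (auto simp: L2_rel_def intro: square_integrable_uminus)

lift_definition scaleR_L2 :: "real \<Rightarrow> L2 \<Rightarrow> L2" is "\<lambda>c f y. c *\<^sub>R f y"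
  by (auto simp: L2_rel_def intro: square_integrable_scaleR)

lift_definition inner_L2 :: "L2 \<Rightarrow> L2 \<Rightarrow> real"
  is "\<lambda>f g. integral\<^sup>L lebesgue (\<lambda>y. f y \<bullet> g y)"
proof (rule integral_cong_AE)
  fix f1 f2 g1 g2 assume "L2_rel f1 f2" "L2_rel g1 g2"
  then show "(\<lambda>y. f1 y \<bullet> g1 y) \<in> borel_measurable lebesgue"
    "(\<lambda>y. f2 y \<bullet> g2 y) \<in> borel_measurable lebesgue"
    "AE y in lebesgue. f1 y \<bullet> g1 y = f2 y \<bullet> g2 y"
    by (auto simp: L2_rel_def square_integrable_def)
qed

definition norm_L2 :: "L2 \<Rightarrow> real" where "norm_L2 f = sqrt (f \<bullet> f)"
definition dist_L2 :: "L2 \<Rightarrow> L2 \<Rightarrow> real" where "dist_L2 f g = norm (f - g)"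
definition sgn_L2 :: "L2 \<Rightarrow> L2" where "sgn_L2 f = inverse (norm f) *\<^sub>R f"
definition uniformity_L2 :: "(L2 \<times> L2) filter"
  where "uniformity_L2 = (INF e\<in>{0 <..}. principal {(x, y). dist x y < e})"
definition open_L2 :: "L2 set \<Rightarrow> bool"
  where "open_L2 S = (\<forall>x\<in>S. \<forall>\<^sub>F (x', y) in uniformity. x' = x \<longrightarrow> y \<in> S)"

instance
proof
  fix a b c :: L2 and r s :: real and U :: "L2 set"
  show "a + b + c = a + (b + c)"
    by transfer (auto simp: L2_rel_def add.assoc intro!: square_integrable_add)
  show "a + b = b + a"
    by transfer (auto simp: L2_rel_def add.commute intro!: square_integrable_add)
  show "0 + a = a" by transfer (auto simp: L2_rel_def)
  show "- a + a = 0" by transfer (auto simp: L2_rel_def)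
  show "a - b = a + - b"
    by transfer (auto simp: L2_rel_def intro!: square_integrable_diff)
  show "r *\<^sub>R (a + b) = r *\<^sub>R a + r *\<^sub>R b"
    by transfer (auto simp: L2_rel_def scaleR_add_right
        intro!: square_integrable_add square_integrable_scaleR)
  show "(r + s) *\<^sub>R a = r *\<^sub>R a + s *\<^sub>R a"
    by transfer (auto simp: L2_rel_def scaleR_add_left
        intro!: square_integrable_add square_integrable_scaleR)
  show "r *\<^sub>R s *\<^sub>R a = (r * s) *\<^sub>R a"
    by transfer (auto simp: L2_rel_def intro!: square_integrable_scaleR)
  show "1 *\<^sub>R a = a" by transfer (auto simp: L2_rel_def)
  show "a \<bullet> b = b \<bullet> a" by transfer (simp add: inner_commute)
  show "(a + b) \<bullet> c = a \<bullet> c + b \<bullet> c"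
    by transfer (simp add: inner_add_left L2_rel_def square_integrable_inner)
  show "(r *\<^sub>R a) \<bullet> b = r * (a \<bullet> b)" by transfer simp
  show "0 \<le> a \<bullet> a" by transfer simp
  show "(a \<bullet> a = 0) = (a = 0)"
  proof transfer
    fix f assume f: "L2_rel f f"
    then have "integrable lebesgue (\<lambda>y. f y \<bullet> f y)"
      by (simp add: L2_rel_def square_integrable_inner)
    then have "(LINT y|lebesgue. f y \<bullet> f y) = 0 \<longleftrightarrow> (AE y in lebesgue. f y \<bullet> f y = 0)"
      by (intro integral_nonneg_eq_0_iff_AE) auto
    then show "((LINT y|lebesgue. f y \<bullet> f y) = 0) = L2_rel f (\<lambda>y. 0)"
      using f by (simp add: L2_rel_def)
  qed
qed (simp_all add: norm_L2_def dist_L2_def sgn_L2_def uniformity_L2_def open_L2_def)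

end

text \<open>The equivalence class of a function; square-integrability is required for a meaningful value.\<close>

definition L2_class :: "(real \<Rightarrow> complex^2) \<Rightarrow> L2"
  where "L2_class f = (if square_integrable f then abs_L2 f else 0)"

lemma square_integrable_rep_L2 [simp]: "square_integrable (rep_L2 F)"
  by (metis Quotient_L2 Quotient_rep_reflp L2_rel_def)

lemma L2_class_rep_L2 [simp]: "L2_class (rep_L2 F) = F"
  by (simp add: L2_class_def Quotient_abs_rep[OF Quotient_L2])

lemma L2_class_eq_iff:
  assumes "square_integrable f" "square_integrable g"
  shows "L2_class f = L2_class g \<longleftrightarrow> (AE y in lebesgue. f y = g y)"
  using assms Quotient_rel[OF Quotient_L2, of f g] by (auto simp: L2_class_def L2_rel_def)

lemma rep_L2_class:
  assumes "square_integrable f"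
  shows "AE y in lebesgue. rep_L2 (L2_class f) y = f y"
  using L2_class_eq_iff[OF square_integrable_rep_L2 assms] L2_class_rep_L2 by blast

lemma L2_class_diff:
  assumes "square_integrable f" "square_integrable g"
  shows "L2_class f - L2_class g = L2_class (\<lambda>y. f y - g y)"
  using assms by (simp add: L2_class_def square_integrable_diff minus_L2.abs_eq L2_rel_def)

lemma L2_class_add:
  assumes "square_integrable f" "square_integrable g"
  shows "L2_class f + L2_class g = L2_class (\<lambda>y. f y + g y)"
  using assms by (simp add: L2_class_def square_integrable_add plus_L2.abs_eq L2_rel_def)

lemma L2_class_0: "L2_class (\<lambda>y. 0) = 0"
  by (simp add: L2_class_def zero_L2.abs_eq)

lemma L2_class_sum:
  assumes "\<And>i. i \<in> I \<Longrightarrow> square_integrable (f i)"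
  shows "square_integrable (\<lambda>y. \<Sum>i\<in>I. f i y) \<and>
         L2_class (\<lambda>y. \<Sum>i\<in>I. f i y) = (\<Sum>i\<in>I. L2_class (f i))"
  using assms
proof (induction I rule: infinite_finite_induct)
  case (insert x F)
  then show ?case by (simp add: L2_class_add[symmetric] square_integrable_add)
qed (simp_all add: L2_class_0)

lemma norm_L2_class:
  assumes "square_integrable f"
  shows "norm (L2_class f) = sqrt (LINT y|lebesgue. (norm (f y))\<^sup>2)"
  using assms
  by (simp add: L2_class_def norm_L2_def inner_L2.abs_eq L2_rel_def power2_norm_eq_inner)

lemma norm_L2_nn_integral:
  assumes "square_integrable f"
  shows "(\<integral>\<^sup>+ y. ennreal ((norm (f y))\<^sup>2) \<partial>lebesgue) = ennreal ((norm (L2_class f))\<^sup>2)"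
  using assms
  by (simp add: norm_L2_class nn_integral_eq_integral square_integrable_def)

instance L2 :: complete_space
proof
  fix X :: "nat \<Rightarrow> L2" assume X: "Cauchy X"
  have "\<exists>N. \<forall>m\<ge>N. \<forall>n\<ge>N. norm (X m - X n) < (1/4)^k" for k :: nat
    using X[unfolded Cauchy_iff] by (simp add: zero_less_power)
  then obtain N where N: "\<And>k m n. m \<ge> N k \<Longrightarrow> n \<ge> N k \<Longrightarrow> norm (X m - X n) < (1/4)^k"
    by metis
  define M where "M k = (\<Sum>i\<le>k. N i) + k" for k
  have M_ge: "M k \<ge> N k" for k
    unfolding M_def by (rule trans_le_add1, rule member_le_sum) auto
  have M_mono: "strict_mono M" by (auto simp: strict_mono_Suc_iff M_def)
  define u where "u k = rep_L2 (X (M k))" for k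
  have su: "square_integrable (u k)" for k by (simp add: u_def)
  have cu: "L2_class (u k) = X (M k)" for k by (simp add: u_def)
  have [measurable]: "u k \<in> borel_measurable lebesgue" for k
    using su by (simp add: square_integrable_def)
  have d: "(\<integral>\<^sup>+ y. ennreal ((norm (u m y - u k y))\<^sup>2) \<partial>lebesgue) \<le> ennreal (((1/4)^k)\<^sup>2)"
    if "k \<le> m" for k m
  proof -
    have "N k \<le> M m" using M_ge[of k] strict_mono_leD[OF M_mono that] by linarith
    then have "norm (X (M m) - X (M k)) \<le> (1/4)^k"
      using N[of k "M m" "M k"] M_ge[of k] by simp
    then have "(norm (X (M m) - X (M k)))\<^sup>2 \<le> ((1/4)^k)\<^sup>2"
      by (rule power_mono) simp
    then show ?thesis
      by (simp add: norm_L2_nn_integral[OF square_integrable_diff[OF su su]]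
          L2_class_diff[symmetric] su cu ennreal_leI del: power_divide)
  qed
  have "(\<integral>\<^sup>+ y. (\<Sum>k. ennreal (2^k * (norm (u (Suc k) y - u k y))\<^sup>2)) \<partial>lebesgue)
      = (\<Sum>k. \<integral>\<^sup>+ y. ennreal (2^k * (norm (u (Suc k) y - u k y))\<^sup>2) \<partial>lebesgue)"
    by (rule nn_integral_suminf) measurable
  also have "\<dots> \<le> (\<Sum>k. ennreal ((1/2)^k))"
  proof (rule suminf_le)
    fix k
    have "(\<integral>\<^sup>+ y. ennreal (2^k * (norm (u (Suc k) y - u k y))\<^sup>2) \<partial>lebesgue)
      = ennreal (2^k) * (\<integral>\<^sup>+ y. ennreal ((norm (u (Suc k) y - u k y))\<^sup>2) \<partial>lebesgue)"
      by (subst nn_integral_cmult[symmetric]) (auto simp: ennreal_mult)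
    also have "\<dots> \<le> ennreal (2^k) * ennreal (((1/4)^k)\<^sup>2)"
      by (intro mult_left_mono d) auto
    also have "\<dots> = ennreal (2^k * ((1/4)^k)\<^sup>2)"
      by (simp add: ennreal_mult)
    also have "\<dots> \<le> ennreal ((1/2)^k)"
    proof (rule ennreal_leI)
      have "(2::real)^k * ((1/4)^k)\<^sup>2 = (1/8)^k"
        by (simp add: power2_eq_square power_mult_distrib[symmetric])
      also have "\<dots> \<le> (1/2)^k" by (rule power_mono) auto
      finally show "(2::real)^k * ((1/4)^k)\<^sup>2 \<le> (1/2)^k" .
    qed
    finally show "(\<integral>\<^sup>+ y. ennreal (2^k * (norm (u (Suc k) y - u k y))\<^sup>2) \<partial>lebesgue)
      \<le> ennreal ((1/2)^k)" .
  qed auto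
  also have "\<dots> < \<infinity>"
    by (subst suminf_ennreal2) (auto simp: summable_geometric)
  finally have "AE y in lebesgue. (\<Sum>k. ennreal (2^k * (norm (u (Suc k) y - u k y))\<^sup>2)) \<noteq> \<infinity>"
    by (intro nn_integral_PInf_AE) auto
  then have conv: "AE y in lebesgue. convergent (\<lambda>k. u k y)"
  proof eventually_elim
    case (elim y)
    then have sm: "summable (\<lambda>k. 2^k * (norm (u (Suc k) y - u k y))\<^sup>2)"
      by (intro summable_suminf_not_top) auto
    then obtain C where C: "\<And>k. norm (2^k * (norm (u (Suc k) y - u k y))\<^sup>2) \<le> C"
      using summable_imp_Bseq unfolding Bseq_def by blast
    have "norm (u (Suc k) y - u k y) \<le> sqrt C * (sqrt (1/2))^k" for k
    proof -
      have "(norm (u (Suc k) y - u k y))\<^sup>2 \<le> C * (1/2)^k"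
        using C[of k] by (simp add: field_simps)
      then have "norm (u (Suc k) y - u k y) \<le> sqrt (C * (1/2)^k)"
        by (rule real_le_rsqrt)
      then show ?thesis by (simp add: real_sqrt_mult real_sqrt_power)
    qed
    moreover have "summable (\<lambda>k. sqrt C * (sqrt (1/2))^k)"
      by (intro summable_mult summable_geometric) auto
    ultimately have "summable (\<lambda>k. u (Suc k) y - u k y)"
      by (rule summable_comparison_test'[where N = 0, rotated])
    then have "convergent (\<lambda>n. \<Sum>k<n. u (Suc k) y - u k y)"
      by (simp add: summable_iff_convergent)
    then have "convergent (\<lambda>n. u n y - u 0 y)"
      by (subst (asm) sum_lessThan_telescope[of "\<lambda>k. u k y"])
    then obtain l where "(\<lambda>n. u n y - u 0 y) \<longlonglongrightarrow> l" by (auto simp: convergent_def)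
    from tendsto_add[OF this tendsto_const[of "u 0 y"]] show ?case
      by (auto simp: convergent_def)
  qed
  define w where "w y = lim (\<lambda>k. u k y)" for y
  have [measurable]: "w \<in> borel_measurable lebesgue"
    unfolding w_def by (rule borel_measurable_lim_metric) measurable
  have lim: "AE y in lebesgue. (\<lambda>k. u k y) \<longlonglongrightarrow> w y"
    using conv by eventually_elim (simp add: w_def convergent_LIMSEQ_iff)
  have dw: "(\<integral>\<^sup>+ y. ennreal ((norm (w y - u k y))\<^sup>2) \<partial>lebesgue) \<le> ennreal (((1/4)^k)\<^sup>2)" for k
  proof -
    have "(\<integral>\<^sup>+ y. ennreal ((norm (w y - u k y))\<^sup>2) \<partial>lebesgue) =
      (\<integral>\<^sup>+ y. liminf (\<lambda>m. ennreal ((norm (u m y - u k y))\<^sup>2)) \<partial>lebesgue)"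
    proof (rule nn_integral_cong_AE)
      show "AE y in lebesgue. ennreal ((norm (w y - u k y))\<^sup>2) =
          liminf (\<lambda>m. ennreal ((norm (u m y - u k y))\<^sup>2))"
        using lim
      proof eventually_elim
        case (elim y)
        then have "(\<lambda>m. ennreal ((norm (u m y - u k y))\<^sup>2)) \<longlonglongrightarrow> ennreal ((norm (w y - u k y))\<^sup>2)"
          by (intro tendsto_intros) 
        then show ?case by (intro lim_imp_Liminf[symmetric]) auto
      qed
    qed
    also have "\<dots> \<le> liminf (\<lambda>m. \<integral>\<^sup>+ y. ennreal ((norm (u m y - u k y))\<^sup>2) \<partial>lebesgue)"
      by (rule nn_integral_liminf) measurable
    also have "\<dots> \<le> ennreal (((1/4)^k)\<^sup>2)"
    proof -
      have "eventually (\<lambda>m. (\<integral>\<^sup>+ y. ennreal ((norm (u m y - u k y))\<^sup>2) \<partial>lebesgue) \<le> ennreal (((1/4)^k)\<^sup>2)) sequentially"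
        using d eventually_ge_at_top by (rule eventually_mono[rotated])
      then have "liminf (\<lambda>m. \<integral>\<^sup>+ y. ennreal ((norm (u m y - u k y))\<^sup>2) \<partial>lebesgue)
          \<le> liminf (\<lambda>m. ennreal (((1/4)^k)\<^sup>2))"
        by (rule Liminf_mono)
      then show ?thesis by (simp add: Liminf_const)
    qed
    finally show ?thesis .
  qed
  have sdw: "square_integrable (\<lambda>y. w y - u k y)" for k
    unfolding square_integrable_def
    using le_less_trans[OF dw[of k] ennreal_less_top]
    by (auto intro!: integrableI_nonneg)
  have sw: "square_integrable w"
    using square_integrable_add[OF sdw[of 0] su[of 0]] by simp
  have "norm (X (M k) - L2_class w) \<le> (1/4)^k" for k
  proof -
    have "ennreal ((norm (L2_class w - X (M k)))\<^sup>2) \<le> ennreal (((1/4)^k)\<^sup>2)"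
      using dw[of k] unfolding norm_L2_nn_integral[OF sdw] cu[symmetric] L2_class_diff[OF sw su] .
    then have "(norm (L2_class w - X (M k)))\<^sup>2 \<le> ((1/4)^k)\<^sup>2"
      by (simp add: ennreal_le_iff)
    then show ?thesis by (subst norm_minus_commute, rule power2_le_imp_le) auto
  qed
  then have "(\<lambda>k. X (M k) - L2_class w) \<longlonglongrightarrow> 0"
    by (rule Lim_null_comparison[OF always_eventually, rule_format])
      (auto intro!: LIMSEQ_power_zero)
  then have "(X \<circ> M) \<longlonglongrightarrow> L2_class w" by (simp add: LIM_zero_iff comp_def)
  then show "convergent X"
    using Cauchy_converges_subseq[OF X M_mono] by (auto simp: convergent_def)
qed


definition ind_L2 :: "real set \<Rightarrow> complex^2 \<Rightarrow> L2"
  where "ind_L2 S v = L2_class (\<lambda>y. indicator S y *\<^sub>R v)"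

lemma square_integrable_indicator:
  assumes "S \<in> lmeasurable"
  shows "square_integrable (\<lambda>y. indicator S y *\<^sub>R v)"
proof -
  have "(\<lambda>y. (norm (indicator S y *\<^sub>R v))\<^sup>2) = (\<lambda>y. indicator S y * (norm v)\<^sup>2)"
    by (auto simp: indicator_def fun_eq_iff)
  moreover have "integrable lebesgue (\<lambda>y. indicator S y * (norm v)\<^sup>2)"
    using assms by (intro integrable_mult_left) (auto simp: fmeasurable_def)
  moreover have "(\<lambda>y. indicator S y *\<^sub>R v) \<in> borel_measurable lebesgue"
    using assms by (auto intro!: borel_measurable_scaleR borel_measurable_indicator)
  ultimately show ?thesis by (simp add: square_integrable_def)
qed

lemma norm_ind_L2:
  assumes "S \<in> lmeasurable"
  shows "norm (ind_L2 S v) = sqrt (measure lebesgue S) * norm v"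
proof -
  have "(\<lambda>y. (norm (indicator S y *\<^sub>R v))\<^sup>2) = (\<lambda>y. indicator S y * (norm v)\<^sup>2)"
    by (auto simp: indicator_def fun_eq_iff)
  then show ?thesis
    using assms by (simp add: ind_L2_def norm_L2_class square_integrable_indicator real_sqrt_mult)
qed

lemma ind_L2_diff_set:
  assumes "S \<in> lmeasurable" "U \<in> lmeasurable" "S \<subseteq> U"
  shows "ind_L2 U v - ind_L2 S v = ind_L2 (U - S) v"
proof -
  have "(\<lambda>y. indicator U y *\<^sub>R v - indicator S y *\<^sub>R v) = (\<lambda>y. indicator (U - S) y *\<^sub>R v)"
    using assms(3) by (auto simp: indicator_def fun_eq_iff)
  then show ?thesis
    using assms by (simp add: ind_L2_def L2_class_diff square_integrable_indicator)
qed

lemma ind_L2_diff_vec: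
  assumes "S \<in> lmeasurable"
  shows "ind_L2 S v - ind_L2 S w = ind_L2 S (v - w)"
  using assms
  by (simp add: ind_L2_def L2_class_diff square_integrable_indicator scaleR_diff_right)

lemma L2_countable_dense: "\<exists>D::L2 set. countable D \<and> closure D = UNIV"
proof -
  obtain B :: "real set set" where B: "countable B" "topological_basis B"
    using ex_countable_basis by blast
  obtain Q :: "(complex^2) set" where Q: "countable Q" "\<And>X. open X \<Longrightarrow> X \<noteq> {} \<Longrightarrow> \<exists>d\<in>Q. d \<in> X"
    by (erule countable_dense_setE) 
  define W where "W = {U \<in> Union ` {F. finite F \<and> F \<subseteq> B}. U \<in> lmeasurable}"
  have W: "countable W"
    unfolding W_def using countable_Collect_finite_subset[OF B(1)]
    by (intro countable_Collect countable_image)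
  define D where "D = (\<lambda>xs. sum_list (map (\<lambda>(U, v). ind_L2 U v) xs)) ` lists (W \<times> Q)"
  have D_countable: "countable D"
    unfolding D_def using W Q(1) by (intro countable_image countable_lists countable_SIGMA)
  have D_add: "f + g \<in> D" if fg: "f \<in> D" "g \<in> D" for f g
  proof -
    obtain xs where xs: "f = sum_list (map (\<lambda>(U, v). ind_L2 U v) xs)" "xs \<in> lists (W \<times> Q)"
      using fg(1) unfolding D_def by (elim imageE) blast
    obtain ys where ys: "g = sum_list (map (\<lambda>(U, v). ind_L2 U v) ys)" "ys \<in> lists (W \<times> Q)"
      using fg(2) unfolding D_def by (elim imageE) blast
    have "f + g = sum_list (map (\<lambda>(U, v). ind_L2 U v) (xs @ ys))" using xs ys by simp
    moreover have "xs @ ys \<in> lists (W \<times> Q)" using xs ys by simp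
    ultimately show ?thesis unfolding D_def by (rule image_eqI)
  qed
  have D_0: "0 \<in> D" unfolding D_def by (rule image_eqI[of _ _ "[]"]) auto
  have C_add: "f + g \<in> closure D" if fg: "f \<in> closure D" "g \<in> closure D" for f g
  proof -
    obtain a where "\<And>n. a n \<in> D" "a \<longlonglongrightarrow> f"
      using fg(1) unfolding closure_sequential by blast
    moreover obtain b where "\<And>n. b n \<in> D" "b \<longlonglongrightarrow> g"
      using fg(2) unfolding closure_sequential by blast
    ultimately have "(\<forall>n. a n + b n \<in> D) \<and> (\<lambda>n. a n + b n) \<longlonglongrightarrow> f + g"
      by (auto intro: D_add tendsto_add)
    then show ?thesis unfolding closure_sequential by (rule exI[of _ "\<lambda>n. a n + b n"])
  qed
  have C_sum: "(\<Sum>i\<in>I. f i) \<in> closure D" if "\<And>i. i \<in> I \<Longrightarrow> f i \<in> closure D"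
    for I :: "(complex^2) set" and f
    using that
  proof (induction I rule: infinite_finite_induct)
    case (insert x F)
    then show ?case by (simp add: C_add)
  qed (use D_0 closure_subset in auto)
  have C_lim: "l \<in> closure D" if "\<And>n. a n \<in> closure D" "a \<longlonglongrightarrow> l" for a l
    using closed_sequentially[OF closed_closure that] .
  have W_C: "ind_L2 U v \<in> closure D" if U: "U \<in> W" for U v
  proof (subst closure_approachable, intro allI impI)
    fix e :: real assume e: "e > 0"
    have Um: "U \<in> lmeasurable" using U by (simp add: W_def)
    define d where "d = e / (sqrt (measure lebesgue U) + 1)"
    have pos: "sqrt (measure lebesgue U) + 1 > 0"
      by (simp add: add_nonneg_pos)
    then have "d > 0" using e by (simp add: d_def)
    then obtain q where q: "q \<in> Q" "q \<in> ball v d" using Q(2)[of "ball v d"] by auto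
    have "ind_L2 U q \<in> D"
      unfolding D_def using U q by (intro image_eqI[of _ _ "[(U, q)]"]) auto
    moreover have "dist (ind_L2 U q) (ind_L2 U v) < e"
    proof -
      have "dist (ind_L2 U q) (ind_L2 U v) = sqrt (measure lebesgue U) * norm (q - v)"
        by (simp add: dist_norm ind_L2_diff_vec norm_ind_L2 Um)
      also have "\<dots> \<le> sqrt (measure lebesgue U) * d"
        using q by (intro mult_left_mono) (auto simp: dist_norm norm_minus_commute)
      also have "\<dots> < (sqrt (measure lebesgue U) + 1) * d"
        using \<open>d > 0\<close> by simp
      also have "\<dots> = e" using pos by (simp add: d_def)
      finally show ?thesis .
    qed
    ultimately show "\<exists>y\<in>D. dist y (ind_L2 U v) < e" by blast
  qed
  have open_C: "ind_L2 U v \<in> closure D" if U: "open U" "U \<in> lmeasurable" for U v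
  proof (cases "U = {}")
    case True
    then show ?thesis using D_0 closure_subset by (auto simp: ind_L2_def L2_class_0)
  next
    case False
    obtain B' where B': "B' \<subseteq> B" "\<Union>B' = U"
      using B(2) U(1) unfolding topological_basis_def by blast
    have "B' \<noteq> {}" using False B' by auto
    have cB': "countable B'" using B' B(1) countable_subset by blast
    define E where "E n = (\<Union>i\<le>n. from_nat_into B' i)" for n :: nat
    have fB: "from_nat_into B' i \<in> B'" for i
      using \<open>B' \<noteq> {}\<close> by (rule from_nat_into)
    have EU: "E n \<subseteq> U" for n using fB B' by (auto simp: E_def)
    have UE: "(\<Union>n. E n) = U"
    proof
      show "U \<subseteq> (\<Union>n. E n)"
      proof
        fix y assume "y \<in> U"
        then obtain b where "b \<in> B'" "y \<in> b" using B' by blast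
        moreover obtain i where "from_nat_into B' i = b"
          using from_nat_into_surj[OF cB' \<open>b \<in> B'\<close>] by blast
        ultimately show "y \<in> (\<Union>n. E n)" by (auto simp: E_def)
      qed
    qed (use EU in blast)
    have "open (E n)" for n
      unfolding E_def using fB B' topological_basis_open[OF B(2)] by blast
    then have "E n \<in> sets lebesgue" for n
      by (intro sets_completionI_sets) simp
    then have Em: "E n \<in> lmeasurable" for n
      by (rule fmeasurableI2[OF U(2) EU])
    have EW: "E n \<in> W" for n
    proof -
      have "E n = \<Union> (from_nat_into B' ` {..n})" by (simp add: E_def)
      moreover have "finite (from_nat_into B' ` {..n})" "from_nat_into B' ` {..n} \<subseteq> B"
        using fB B' by auto
      ultimately have "E n \<in> Union ` {F. finite F \<and> F \<subseteq> B}" by blast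
      then show ?thesis using Em[of n] by (simp add: W_def)
    qed
    have "incseq E" by (auto simp: incseq_def E_def intro: order.trans)
    then have "(\<lambda>n. measure lebesgue (E n)) \<longlonglongrightarrow> measure lebesgue (\<Union>n. E n)"
      using Em U(2) UE
      by (intro Lim_measure_incseq) (auto simp: fmeasurable_def)
    then have "(\<lambda>n. measure lebesgue U - measure lebesgue (E n))
        \<longlonglongrightarrow> measure lebesgue U - measure lebesgue U"
      unfolding UE by (intro tendsto_diff tendsto_const)
    then have "(\<lambda>n. measure lebesgue U - measure lebesgue (E n)) \<longlonglongrightarrow> 0" by simp
    then have "(\<lambda>n. sqrt (measure lebesgue U - measure lebesgue (E n)) * norm v) \<longlonglongrightarrow> sqrt 0 * norm v"
      by (intro tendsto_mult tendsto_real_sqrt tendsto_const)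
    moreover have nE: "norm (ind_L2 (E n) v - ind_L2 U v)
        = sqrt (measure lebesgue U - measure lebesgue (E n)) * norm v" for n
    proof -
      have "norm (ind_L2 (E n) v - ind_L2 U v) = norm (ind_L2 (U - E n) v)"
        by (subst norm_minus_commute) (simp add: ind_L2_diff_set Em U EU)
      also have "\<dots> = sqrt (measure lebesgue (U - E n)) * norm v"
        using Em U by (intro norm_ind_L2) (auto intro: fmeasurable.Diff)
      also have "measure lebesgue (U - E n) = measure lebesgue U - measure lebesgue (E n)"
        using Em U EU by (intro measurable_measure_Diff) auto
      finally show ?thesis .
    qed
    ultimately have "(\<lambda>n. norm (ind_L2 (E n) v - ind_L2 U v)) \<longlonglongrightarrow> 0"
      unfolding nE by (simp only: real_sqrt_zero mult_zero_left)
    then have "(\<lambda>n. ind_L2 (E n) v) \<longlonglongrightarrow> ind_L2 U v"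
      by (rule LIM_zero_cancel[OF tendsto_norm_zero_cancel])
    then show ?thesis by (rule C_lim[OF W_C[OF EW]])
  qed
  have meas_C: "ind_L2 S v \<in> closure D" if S: "S \<in> lmeasurable" for S v
  proof -
    have "\<exists>U. open U \<and> S \<subseteq> U \<and> U \<in> lmeasurable \<and> measure lebesgue (U - S) < inverse (real (Suc n))"
      for n
    proof -
      have pos: "inverse (real (Suc n)) > 0" by simp
      obtain U where U: "open U" "S \<subseteq> U" "U - S \<in> lmeasurable"
          "emeasure lebesgue (U - S) < ennreal (inverse (real (Suc n)))"
        by (rule sets_lebesgue_outer_open[OF fmeasurableD[OF S] pos])
      have "S \<union> (U - S) = U" using U(2) by blast
      then have "U \<in> lmeasurable" using fmeasurable.Un[OF S U(3)] by metis
      moreover have "measure lebesgue (U - S) < inverse (real (Suc n))"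
        using U(4) pos unfolding emeasure_eq_measure2[OF U(3)]
        by (subst (asm) ennreal_less_iff) auto
      ultimately show ?thesis using U(1,2) by blast
    qed
    then obtain U where U: "\<And>n. open (U n)" "\<And>n. S \<subseteq> U n" "\<And>n. U n \<in> lmeasurable"
      "\<And>n. measure lebesgue (U n - S) < inverse (real (Suc n))" by metis
    have "norm (ind_L2 (U n) v - ind_L2 S v) \<le> sqrt (inverse (real (Suc n))) * norm v" for n
    proof -
      have "norm (ind_L2 (U n) v - ind_L2 S v) = sqrt (measure lebesgue (U n - S)) * norm v"
        unfolding ind_L2_diff_set[OF S U(3) U(2)]
        by (rule norm_ind_L2[OF fmeasurable.Diff[OF U(3) S]])
      also have "\<dots> \<le> sqrt (inverse (real (Suc n))) * norm v"
        by (intro mult_right_mono real_sqrt_le_mono less_imp_le[OF U(4)] norm_ge_zero)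
      finally show ?thesis .
    qed
    moreover have "(\<lambda>n. sqrt (inverse (real (Suc n))) * norm v) \<longlonglongrightarrow> 0"
      using tendsto_mult[OF tendsto_real_sqrt[OF LIMSEQ_inverse_real_of_nat] tendsto_const[of "norm v"]]
      by simp
    ultimately have "(\<lambda>n. ind_L2 (U n) v - ind_L2 S v) \<longlonglongrightarrow> 0"
      by (rule Lim_null_comparison[OF always_eventually, rule_format])
    then have "(\<lambda>n. ind_L2 (U n) v) \<longlonglongrightarrow> ind_L2 S v" by (simp add: LIM_zero_iff)
    then show ?thesis by (rule C_lim[OF open_C[OF U(1,3)]])
  qed
  have "F \<in> closure D" for F
  proof -
    define f where "f = rep_L2 F"
    have sf: "square_integrable f" and F: "L2_class f = F" by (simp_all add: f_def)
    have [measurable]: "f \<in> borel_measurable lebesgue" using sf by (simp add: square_integrable_def)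
    obtain s where s: "\<And>i. simple_function lebesgue (s i)" "\<And>y. (\<lambda>i. s i y) \<longlonglongrightarrow> f y"
      "\<And>i y. norm (s i y) \<le> 2 * norm (f y)"
      using borel_measurable_implies_sequence_metric[of f lebesgue 0] by auto
    have [measurable]: "s i \<in> borel_measurable lebesgue" for i
      using s(1) by (rule borel_measurable_simple_function)
    have int4: "integrable lebesgue (\<lambda>y. 4 * (norm (f y))\<^sup>2)"
      using sf by (simp add: square_integrable_def)
    have bd: "(norm (s i y))\<^sup>2 \<le> 4 * (norm (f y))\<^sup>2" for i y
      using power_mono[OF s(3)[of i y], of 2] by (simp add: power_mult_distrib)
    have ss: "square_integrable (s i)" for i
      unfolding square_integrable_def using bd
      by (auto intro!: Bochner_Integration.integrable_bound[OF int4])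
    have sC: "L2_class (s i) \<in> closure D" for i
    proof -
      let ?I = "range (s i) - {0}"
      let ?S = "\<lambda>v. s i -` {v}"
      have fin: "finite ?I" using simple_functionD(1)[OF s(1)[of i]] by simp
      have lm: "?S v \<in> lmeasurable" if "v \<in> ?I" for v
      proof -
        have "?S v \<in> sets lebesgue" using simple_functionD(2)[OF s(1)[of i], of "{v}"] by simp
        moreover have "integrable lebesgue (\<lambda>y. indicator (?S v) y * (norm v)\<^sup>2)"
        proof (rule Bochner_Integration.integrable_bound)
          show "integrable lebesgue (\<lambda>y. (norm (s i y))\<^sup>2)"
            using ss by (simp add: square_integrable_def)
          show "(\<lambda>y. indicator (?S v) y * (norm v)\<^sup>2) \<in> borel_measurable lebesgue"
            using calculation by auto
        qed (auto simp: indicator_def)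
        then have "integrable lebesgue (indicator (?S v) :: real \<Rightarrow> real)"
          using that by (simp add: integrable_mult_left_iff)
        ultimately show ?thesis by (simp add: fmeasurable_def integrable_indicator_iff)
      qed
      have eq: "s i = (\<lambda>y. \<Sum>v\<in>?I. indicator (?S v) y *\<^sub>R v)"
      proof
        fix y
        have "(\<Sum>v\<in>?I. indicator (?S v) y *\<^sub>R v) = (\<Sum>v\<in>?I. if s i y = v then v else 0)"
          by (rule sum.cong) (auto simp: indicator_def)
        also have "\<dots> = s i y" using fin by (auto simp: sum.delta)
        finally show "s i y = (\<Sum>v\<in>?I. indicator (?S v) y *\<^sub>R v)" by simp
      qed
      have "L2_class (\<lambda>y. \<Sum>v\<in>?I. indicator (?S v) y *\<^sub>R v) = (\<Sum>v\<in>?I. ind_L2 (?S v) v)"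
        unfolding ind_L2_def using L2_class_sum[of ?I "\<lambda>v y. indicator (?S v) y *\<^sub>R v"]
          square_integrable_indicator[OF lm] by blast
      then have "L2_class (s i) = (\<Sum>v\<in>?I. ind_L2 (?S v) v)" using eq by simp
      then show ?thesis using C_sum[of ?I "\<lambda>v. ind_L2 (?S v) v"] meas_C[OF lm] by simp
    qed
    have int9: "integrable lebesgue (\<lambda>y. 9 * (norm (f y))\<^sup>2)"
      using sf by (simp add: square_integrable_def)
    have "(\<lambda>i. LINT y|lebesgue. (norm (s i y - f y))\<^sup>2) \<longlonglongrightarrow> (LINT y::real|lebesgue. (0::real))"
    proof (rule integral_dominated_convergence[where w = "\<lambda>y. 9 * (norm (f y))\<^sup>2"])
      show "AE y in lebesgue. (\<lambda>i. (norm (s i y - f y))\<^sup>2) \<longlonglongrightarrow> 0"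
      proof (rule AE_I2)
        fix y
        have "(\<lambda>i. (norm (s i y - f y))\<^sup>2) \<longlonglongrightarrow> (norm (f y - f y))\<^sup>2"
          by (intro tendsto_intros s)
        then show "(\<lambda>i. (norm (s i y - f y))\<^sup>2) \<longlonglongrightarrow> 0" by simp
      qed
      show "AE y in lebesgue. norm ((norm (s i y - f y))\<^sup>2) \<le> 9 * (norm (f y))\<^sup>2" for i
      proof (rule AE_I2)
        fix y
        have "norm (s i y - f y) \<le> 3 * norm (f y)"
          using norm_triangle_ineq4[of "s i y" "f y"] s(3)[of i y] by linarith
        from power_mono[OF this, of 2]
        show "norm ((norm (s i y - f y))\<^sup>2) \<le> 9 * (norm (f y))\<^sup>2"
          by (simp add: power_mult_distrib)
      qed
    qed (use int9 in measurable)
    then have "(\<lambda>i. sqrt (LINT y|lebesgue. (norm (s i y - f y))\<^sup>2)) \<longlonglongrightarrow> sqrt 0"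
      by (intro tendsto_real_sqrt) simp
    then have "(\<lambda>i. norm (L2_class (s i) - F)) \<longlonglongrightarrow> 0"
      by (simp add: F[symmetric] L2_class_diff ss sf norm_L2_class square_integrable_diff)
    then have "(\<lambda>i. L2_class (s i)) \<longlonglongrightarrow> F"
      by (rule LIM_zero_cancel[OF tendsto_norm_zero_cancel])
    then show ?thesis by (rule C_lim[OF sC])
  qed
  then show ?thesis using D_countable by blast
qed

instance L2 :: second_countable_topology
proof
  obtain D :: "L2 set" where D: "countable D" "closure D = UNIV"
    using L2_countable_dense by blast
  define B where "B = (\<lambda>(d, n). ball d (inverse (Suc n))) ` (D \<times> (UNIV :: nat set))"
  have "topological_basis B"
  proof (rule topological_basisI)
    show "open b" if "b \<in> B" for b using that by (auto simp: B_def)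
    fix U :: "L2 set" and x assume "open U" "x \<in> U"
    then obtain e where e: "e > 0" "ball x e \<subseteq> U" by (meson open_contains_ball)
    obtain n where n: "inverse (real (Suc n)) < e / 2"
      using reals_Archimedean[of "e / 2"] e by auto
    have "x \<in> closure D" using D(2) by simp
    moreover have "inverse (real (Suc n)) > 0" by simp
    ultimately obtain d where d: "d \<in> D" "dist d x < inverse (real (Suc n))"
      unfolding closure_approachable by blast
    have "ball d (inverse (Suc n)) \<subseteq> ball x e"
    proof
      fix z assume "z \<in> ball d (inverse (Suc n))"
      then have "dist x z < e"
        using dist_triangle[of x z d] d(2) n by (simp add: dist_commute)
      then show "z \<in> ball x e" by simp
    qed
    then have "ball d (inverse (Suc n)) \<subseteq> U" using e(2) by blast
    moreover have "ball d (inverse (Suc n)) \<in> B"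
      unfolding B_def by (rule image_eqI[of _ _ "(d, n)"]) (use d in auto)
    moreover have "x \<in> ball d (inverse (Suc n))" using d by simp
    ultimately show "\<exists>B'\<in>B. x \<in> B' \<and> B' \<subseteq> U" by blast
  qed
  moreover have "countable B" unfolding B_def using D by auto
  ultimately show "\<exists>B::L2 set set. countable B \<and> open = generate_topology B"
    using topological_basis_imp_subbasis by blast
qed

instance L2 :: banach ..


section \<open>Function spaces\<close>

text \<open>$L^2(S;\mathbb{C}^2)$ is identified with the closed subspace of fields on the line that
  vanish almost everywhere outside \<open>S\<close>.\<close>

definition L2_on :: "real set \<Rightarrow> L2 set"
  where "L2_on S = {F. AE y in lebesgue. y \<notin> S \<longrightarrow> rep_L2 F y = 0}"

definition scaleC_L2 :: "complex \<Rightarrow> L2 \<Rightarrow> L2"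
  where "scaleC_L2 c F = L2_class (\<lambda>y. c *s rep_L2 F y)"

definition L_infinity :: "'a::euclidean_space set \<Rightarrow> ('a \<Rightarrow> complex) \<Rightarrow> bool"
  where "L_infinity \<Omega> V \<longleftrightarrow> V \<in> borel_measurable (lebesgue_on \<Omega>) \<and>
    (\<exists>C. AE p in lebesgue_on \<Omega>. norm (V p) \<le> C)"

definition smooth :: "(real \<Rightarrow> 'a::real_normed_vector) \<Rightarrow> bool"
  where "smooth f \<longleftrightarrow>
    (\<exists>D. D 0 = f \<and> (\<forall>(n::nat) y. (D n has_vector_derivative D (Suc n) y) (at y)))"

definition test_function :: "real set \<Rightarrow> (real \<Rightarrow> 'a::real_normed_vector) \<Rightarrow> bool"
  where "test_function S f \<longleftrightarrow> smooth f \<and>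
    compact (closure {y. f y \<noteq> 0}) \<and> closure {y. f y \<noteq> 0} \<subseteq> S"

definition has_weak_derivative :: "real set \<Rightarrow> L2 \<Rightarrow> L2 \<Rightarrow> bool"
  where "has_weak_derivative S F H \<longleftrightarrow>
    (\<forall>\<phi>::real \<Rightarrow> real. test_function S \<phi> \<longrightarrow>
      (LINT y|lebesgue_on S. vector_derivative \<phi> (at y) *\<^sub>R rep_L2 F y) =
      - (LINT y|lebesgue_on S. \<phi> y *\<^sub>R rep_L2 H y))"

definition H1 :: "real set \<Rightarrow> L2 set"
  where "H1 S = {F \<in> L2_on S. \<exists>H\<in>L2_on S. has_weak_derivative S F H}"

definition weak_derivative :: "real set \<Rightarrow> L2 \<Rightarrow> L2"
  where "weak_derivative S F = (THE H. H \<in> L2_on S \<and> has_weak_derivative S F H)"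

definition continuous_maps :: "real set \<Rightarrow> L2 set \<Rightarrow> (real \<Rightarrow> L2) set"
  where "continuous_maps I X = {\<psi> \<in> extensional I. \<psi> ` I \<subseteq> X \<and> continuous_on I \<psi>}"


section \<open>Strongly continuous semigroups on a subspace\<close>

definition bounded_operator_on :: "L2 set \<Rightarrow> (L2 \<Rightarrow> L2) \<Rightarrow> bool"
  where "bounded_operator_on X S \<longleftrightarrow> S ` X \<subseteq> X \<and>
    (\<forall>F\<in>X. \<forall>G\<in>X. S (F + G) = S F + S G) \<and>
    (\<forall>c. \<forall>F\<in>X. S (scaleC_L2 c F) = scaleC_L2 c (S F)) \<and>
    (\<exists>C. \<forall>F\<in>X. norm (S F) \<le> C * norm F)"

definition strongly_continuous_semigroup :: "L2 set \<Rightarrow> (real \<Rightarrow> L2 \<Rightarrow> L2) \<Rightarrow> bool"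
  where "strongly_continuous_semigroup X T \<longleftrightarrow>
    (\<forall>x\<ge>0. bounded_operator_on X (T x)) \<and>
    (\<forall>F\<in>X. T 0 F = F) \<and>
    (\<forall>x\<ge>0. \<forall>x'\<ge>0. \<forall>F\<in>X. T (x + x') F = T x (T x' F)) \<and>
    (\<forall>F\<in>X. ((\<lambda>x. T x F) \<longlongrightarrow> F) (at_right 0))"

text \<open>The generator of \<open>T\<close>, including its domain, is exactly \<open>A\<close> with domain \<open>Dom\<close>.\<close>

definition semigroup_generated_by ::
    "L2 set \<Rightarrow> L2 set \<Rightarrow> (L2 \<Rightarrow> L2) \<Rightarrow> (real \<Rightarrow> L2 \<Rightarrow> L2) \<Rightarrow> bool"
  where "semigroup_generated_by X Dom A T \<longleftrightarrow> strongly_continuous_semigroup X T \<and>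
    (\<forall>F\<in>X. \<forall>G\<in>X. ((\<lambda>x. (1 / x) *\<^sub>R (T x F - F)) \<longlongrightarrow> G) (at_right 0) \<longleftrightarrow>
      F \<in> Dom \<and> G = A F)"


section \<open>The Dirac problem\<close>

definition dirac_alpha :: "complex^2^2"
  where "dirac_alpha = vector [vector [0, 1], vector [1, 0]]"

definition dirac_beta :: "complex^2^2"
  where "dirac_beta = vector [vector [1, 0], vector [0, -1]]"

text \<open>The boundary values are those of the continuous representative \<open>u\<close> on the closed interval.\<close>

definition dirac_domain :: "real \<Rightarrow> L2 set"
  where "dirac_domain Ly = {F \<in> H1 {0<..<Ly}.
    \<exists>u. continuous_on {0..Ly} u \<and> (AE y in lebesgue_on {0<..<Ly}. rep_L2 F y = u y) \<and>
      u 0 $ 2 = 0 \<and> u Ly $ 1 = 0}"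

definition dirac_op :: "real \<Rightarrow> real \<Rightarrow> L2 \<Rightarrow> L2"
  where "dirac_op k Ly F = L2_class (\<lambda>y.
    dirac_alpha *v rep_L2 (weak_derivative {0<..<Ly} F) y -
    (\<i> * complex_of_real k) *s (dirac_beta *v rep_L2 F y))"

text \<open>For a potential in $L^\infty$ the product below is square-integrable for almost every \<open>x\<close>;
  for the remaining \<open>x\<close> it may be junk, which does not affect the integral equation.\<close>

definition potential_op :: "real \<Rightarrow> (real \<times> real \<Rightarrow> complex) \<Rightarrow> real \<Rightarrow> L2 \<Rightarrow> L2"
  where "potential_op k V x F =
    L2_class (\<lambda>y. (- \<i> * complex_of_real k * V (x, y)) *s rep_L2 F y)"

text \<open>Multiplying
  $-\mathrm{i}\,\partial_x\psi + \mathrm{i}\,\alpha\,\partial_y\psi + k(\beta + V)\psi = 0$ by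
  $\mathrm{i}$ gives $\partial_x\psi = A\psi + B(x)\psi$ with \<open>A = dirac_op k Ly\<close> on
  \<open>dirac_domain Ly\<close>, which carries the boundary conditions, and \<open>B x = potential_op k V x\<close>.
  A mild solution of the problem with initial value \<open>g\<close> solves the corresponding Duhamel equation,
  the integral being a Bochner integral in \<open>L2\<close> and \<open>T\<close> the semigroup generated by \<open>A\<close>.\<close>

definition mild_solution ::
    "real \<Rightarrow> real \<Rightarrow> real \<Rightarrow> (real \<times> real \<Rightarrow> complex) \<Rightarrow> (real \<Rightarrow> L2 \<Rightarrow> L2) \<Rightarrow>
     (real \<Rightarrow> complex^2) \<Rightarrow> (real \<Rightarrow> L2) \<Rightarrow> bool"
  where "mild_solution k Lx Ly V T g \<psi> \<longleftrightarrow>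
    \<psi> \<in> continuous_maps {0..Lx} (L2_on {0<..<Ly}) \<and>
    (\<forall>x\<in>{0..Lx}.
      integrable (lebesgue_on {0..x}) (\<lambda>x'. T (x - x') (potential_op k V x' (\<psi> x'))) \<and>
      \<psi> x = T x (L2_class g) +
        (LINT x'|lebesgue_on {0..x}. T (x - x') (potential_op k V x' (\<psi> x'))))"

end

theory Submission
  imports Defs
begin

text \<open>
  The integral equation is a linear Volterra equation $\psi(x) = \varphi(x) + \int_0^x K(x,s)\psi(s)\,ds$
  with $\varphi(x) = T(x)g$ and $K(x,s) = T(x-s)B(s)$. If the kernel is bounded by $C$, then in the supremum norm
  weighted by $e^{-2Cx}$ the integral operator is a contraction with factor $1/2$ on any interval,
  so Picard iteration gives existence and the same estimate gives uniqueness
  (\<open>volterra_contraction\<close>, \<open>volterra_solvable\<close>, \<open>volterra_unique\<close>). The work lies in showing that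
  $K$ is such a kernel (\<open>kernel_is_volterra\<close>).

  Boundedness of $K$ rests on $\|T(s)\|$ being bounded on compact intervals, which for a strongly continuous
  semigroup follows from the uniform boundedness principle (\<open>locally_bounded\<close>) and in turn implies joint
  continuity of $(s,F) \mapsto T(s)F$ (\<open>jointly_continuous\<close>).

  The Bochner integral needs $s \mapsto T(x-s)B(s)\psi(s)$ to be strongly measurable although $V$ is only
  measurable. Since $L^2$ is separable, weak measurability is enough (\<open>borel_measurable_if_inner\<close>). For a
  constant field it follows from Fubini's theorem; for a measurable path the multiplication operator is
  moved to its adjoint, which acts on a constant field again (\<open>borel_measurable_mult\<close>).
  Null sets are dealt with once, by a bounded Borel version of the potential all of whose slices
  are bounded and measurable (\<open>L_infinity_borel_version\<close>).

  The semigroup acts on the subspace of fields supported in the interval. It is extended to all of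
  \<open>L2\<close> by precomposition with the orthogonal projection onto the subspace (\<open>C0_semigroup_extension\<close>), so
  that the analysis takes place in a Banach space; that the solution stays in the subspace is then
  read off from the equation.
\<close>

section \<open>Strongly continuous semigroups\<close>

text \<open>The closed sets \<open>E m\<close> of vectors whose orbit stays below \<open>m\<close> cover the space, so by Baire one of
  them contains a ball; linearity carries the bound from that ball to the whole space.\<close>

lemma uniform_boundedness:
  fixes T :: "nat \<Rightarrow> 'a::banach \<Rightarrow> 'b::real_normed_vector"
  assumes lin: "\<And>n. bounded_linear (T n)"
    and bdd: "\<And>F. bounded (range (\<lambda>n. T n F))"
  shows "\<exists>M. \<forall>n F. norm (T n F) \<le> M * norm F"
proof -
  define E where "E m = {F. \<forall>n. norm (T n F) \<le> real m}" for m :: nat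
  have cont: "continuous_on UNIV (T n)" for n
    by (rule bounded_linear.continuous_on[OF lin continuous_on_id])
  have closed: "closed (E m)" for m
    unfolding E_def
    by (intro closed_Collect_all closed_Collect_le continuous_intros
        continuous_on_compose2[OF cont]) auto
  have cover: "(\<Union>m. E m) = UNIV"
  proof -
    have "\<exists>m. F \<in> E m" for F
    proof -
      obtain b where b: "\<And>n. norm (T n F) \<le> b" using bdd[of F] by (auto simp: bounded_iff)
      obtain m where "b \<le> real m" using real_arch_simple by blast
      then show ?thesis using b by (auto simp: E_def intro: order_trans)
    qed
    then show ?thesis by blast
  qed
  have "\<exists>m. interior (E m) \<noteq> {}"
  proof (rule ccontr)
    assume "\<not> ?thesis"
    then have "Met_TC.mtopology interior_of \<Union> (range E) = {}"
      by (intro Met_TC.metric_Baire_category_alt) (auto simp: closed complete_UNIV)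
    then show False using cover by simp
  qed
  then obtain m F0 r where r: "r > 0" and sub: "cball F0 r \<subseteq> E m"
    by (metis all_not_in_conv mem_interior_cball)
  have "norm (T n F) \<le> (2 * real m / r) * norm F" for n F
  proof (cases "F = 0")
    case True
    then show ?thesis using lin[of n] by (simp add: linear_simps)
  next
    case False
    define c where "c = r / norm F"
    have c: "c > 0" using False r by (simp add: c_def)
    have "F0 + c *\<^sub>R F \<in> cball F0 r" "F0 \<in> cball F0 r"
      using False r by (auto simp: c_def dist_norm)
    then have "F0 + c *\<^sub>R F \<in> E m" "F0 \<in> E m"
      using sub by blast+
    then have "norm (T n (F0 + c *\<^sub>R F)) \<le> m" "norm (T n F0) \<le> m"
      by (auto simp: E_def)
    moreover have "T n (F0 + c *\<^sub>R F) = T n F0 + c *\<^sub>R T n F"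
      using lin[of n] by (simp add: linear_simps)
    ultimately have "norm (c *\<^sub>R T n F) \<le> 2 * m"
      using norm_triangle_ineq4[of "T n F0 + c *\<^sub>R T n F" "T n F0"] by simp
    then have "norm (T n F) \<le> 2 * m / c" using c by (simp add: field_simps)
    then show ?thesis by (simp add: c_def)
  qed
  then show ?thesis by blast
qed

text \<open>\<open>U 0\<close> is a projection (by \<open>add\<close>) and may differ from the identity. This admits a semigroup
  given on a closed subspace, precomposed with a projection onto that subspace, and so keeps all
  operators defined on a full Banach space.\<close>

locale C0_semigroup =
  fixes U :: "real \<Rightarrow> 'a::banach \<Rightarrow> 'a"
  assumes bounded_linear: "s \<ge> 0 \<Longrightarrow> bounded_linear (U s)"
    and add: "s \<ge> 0 \<Longrightarrow> t \<ge> 0 \<Longrightarrow> U (s + t) F = U s (U t F)"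
    and right_continuous: "((\<lambda>s. U s F) \<longlongrightarrow> U 0 F) (at_right 0)"
begin

text \<open>If the bound failed on every interval \<open>(0, \<delta>]\<close>, there would be operators \<open>U (s n)\<close> with
  \<open>s n\<close> tending to 0 and norms exceeding \<open>n\<close>. Each of their orbits converges, hence is bounded, which
  contradicts uniform boundedness.\<close>

lemma bounded_near_0: "\<exists>\<delta>>0. \<exists>M\<ge>1. \<forall>s\<in>{0..\<delta>}. \<forall>F. norm (U s F) \<le> M * norm F"
proof -
  have "\<exists>\<delta>>0. \<exists>M. \<forall>s\<in>{0<..\<delta>}. \<forall>F. norm (U s F) \<le> M * norm F"
  proof (rule ccontr)
    assume neg: "\<not> ?thesis"
    have "\<exists>s F. s \<in> {0<..inverse (real (Suc n))} \<and> norm (U s F) > real n * norm F" for n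
    proof -
      have "inverse (real (Suc n)) > 0" by simp
      with neg show ?thesis by (meson not_le)
    qed
    then obtain s F where s: "\<And>n. s n \<in> {0<..inverse (real (Suc n))}"
      and F: "\<And>n. norm (U (s n) (F n)) > real n * norm (F n)" by metis
    have "s \<longlonglongrightarrow> 0"
      by (rule tendsto_sandwich[OF _ _ tendsto_const LIMSEQ_inverse_real_of_nat])
        (use s in \<open>auto intro!: always_eventually simp: less_imp_le\<close>)
    then have lim: "filterlim s (at_right 0) sequentially"
      using s by (auto simp: filterlim_at less_imp_neq[THEN not_sym] intro!: always_eventually)
    have "bounded (range (\<lambda>n. U (s n) G))" for G
      by (rule convergent_imp_bounded[OF filterlim_compose[OF right_continuous lim]])
    moreover have "bounded_linear (U (s n))" for n
      using s[of n] by (intro bounded_linear) auto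
    ultimately obtain M where M: "\<And>n G. norm (U (s n) G) \<le> M * norm G"
      using uniform_boundedness[of "\<lambda>n. U (s n)"] by blast
    obtain n where n: "M \<le> real n" using real_arch_simple by blast
    have "norm (U (s n) (F n)) \<le> real n * norm (F n)"
      using M[of n "F n"] mult_right_mono[OF n norm_ge_zero[of "F n"]] by linarith
    with F[of n] show False by simp
  qed
  then obtain \<delta> M where \<delta>: "\<delta> > 0" and M: "\<And>s F. s \<in> {0<..\<delta>} \<Longrightarrow> norm (U s F) \<le> M * norm F"
    by blast
  obtain M0 where M0: "\<And>F. norm (U 0 F) \<le> norm F * M0"
    using bounded_linear.bounded[OF bounded_linear[of 0]] by auto
  define M' where "M' = max 1 (max M M0)"
  have "norm (U s F) \<le> M' * norm F" if "s \<in> {0..\<delta>}" for s F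
  proof (cases "s = 0")
    case True
    have "M0 * norm F \<le> M' * norm F" by (intro mult_right_mono) (auto simp: M'_def)
    then show ?thesis using M0[of F] True by (simp add: mult.commute)
  next
    case False
    have "M * norm F \<le> M' * norm F" by (intro mult_right_mono) (auto simp: M'_def)
    then show ?thesis using M[of s F] False that by auto
  qed
  moreover have "M' \<ge> 1" by (simp add: M'_def)
  ultimately show ?thesis using \<delta> by blast
qed

text \<open>An interval \<open>[0, L]\<close> is covered by finitely many steps of length \<open>\<delta>\<close>, and each step costs one more
  factor \<open>M\<close>.\<close>

lemma locally_bounded: "\<exists>M>0. \<forall>s\<in>{0..L}. \<forall>F. norm (U s F) \<le> M * norm F"
proof -
  obtain \<delta> M where \<delta>: "\<delta> > 0" and M: "M \<ge> 1"
    and bd: "\<And>s F. s \<in> {0..\<delta>} \<Longrightarrow> norm (U s F) \<le> M * norm F"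
    using bounded_near_0 by blast
  have pow: "norm (U s F) \<le> M ^ Suc n * norm F" if "s \<in> {0..real (Suc n) * \<delta>}" for n s F
    using that
  proof (induction n arbitrary: s)
    case 0
    then show ?case using bd[of s] by simp
  next
    case (Suc n)
    show ?case
    proof (cases "s \<le> \<delta>")
      case True
      have "M ^ 1 \<le> M ^ Suc (Suc n)" using M by (intro power_increasing) auto
      then have "M * norm F \<le> M ^ Suc (Suc n) * norm F" by (intro mult_right_mono) auto
      then show ?thesis using bd[of s F] True Suc.prems by auto
    next
      case False
      have "s - \<delta> \<in> {0..real (Suc n) * \<delta>}" using Suc.prems False by (auto simp: algebra_simps)
      from Suc.IH[OF this] have IH: "norm (U (s - \<delta>) F) \<le> M ^ Suc n * norm F" .
      have "U s F = U \<delta> (U (s - \<delta>) F)" using add[of \<delta> "s - \<delta>" F] False \<delta> by simp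
      then have "norm (U s F) \<le> M * norm (U (s - \<delta>) F)" using bd[of \<delta>] \<delta> by simp
      also have "\<dots> \<le> M * (M ^ Suc n * norm F)" using IH M by (intro mult_left_mono) auto
      finally show ?thesis by (simp add: mult.assoc)
    qed
  qed
  obtain n where n: "L \<le> real n * \<delta>" using \<delta> real_arch_simple[of "L / \<delta>"] by (auto simp: field_simps)
  moreover have "real n * \<delta> \<le> real (Suc n) * \<delta>" using \<delta> by simp
  ultimately have "s \<in> {0..real (Suc n) * \<delta>}" if "s \<in> {0..L}" for s using that by auto
  then have "\<forall>s\<in>{0..L}. \<forall>F. norm (U s F) \<le> M ^ Suc n * norm F" using pow by blast
  moreover have "M ^ Suc n > 0" using M by simp
  ultimately show ?thesis by blast
qed

text \<open>Joint continuity follows from local boundedness and the continuity of each orbit. Both one-sided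
  limits of an orbit come from the single estimate \<open>orbit\<close> below, obtained by factoring out the
  operator at the smaller time; continuity at 0 then does the rest.\<close>

lemma jointly_continuous: "continuous_on ({0..} \<times> UNIV) (\<lambda>(s, F). U s F)"
proof (rule continuous_on_sequentiallyI)
  fix u :: "nat \<Rightarrow> real \<times> 'a" and a
  assume u: "\<forall>n. u n \<in> {0..} \<times> UNIV" and a: "a \<in> {0..} \<times> UNIV" and lim: "u \<longlonglongrightarrow> a"
  define s t where "s n = fst (u n)" and "t = fst a" for n
  define F G where "F n = snd (u n)" and "G = snd a" for n
  have nonneg: "s n \<ge> 0" "t \<ge> 0" for n using u a by (auto simp: s_def t_def mem_Times_iff)
  have st: "s \<longlonglongrightarrow> t" and FG: "F \<longlonglongrightarrow> G"
    unfolding s_def[abs_def] t_def F_def[abs_def] G_def by (intro tendsto_intros lim)+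
  obtain L where L: "\<And>n. s n \<le> L" 
    using convergent_imp_bounded[OF st] by (auto simp: bounded_iff abs_le_iff)
  have tL: "t \<le> L" using LIMSEQ_le_const2[OF st] L by blast
  obtain M where M: "M > 0" "\<And>r F. r \<in> {0..L} \<Longrightarrow> norm (U r F) \<le> M * norm F"
    using locally_bounded[of L] by blast
  have orbit: "norm (U q H - U p H) \<le> M * norm (U (q - p) H - U 0 H)"
    if "0 \<le> p" "p \<le> q" "q \<le> L" for p q H
  proof -
    have "U q H = U p (U (q - p) H)" "U p H = U p (U 0 H)"
      using add[of p "q - p" H] add[of p 0 H] that by auto
    then have "U q H - U p H = U p (U (q - p) H - U 0 H)"
      using bounded_linear[of p] that by (simp add: linear_simps)
    then show ?thesis using M(2)[of p] that by auto
  qed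
  have bound: "norm (U (s n) (F n) - U t G)
      \<le> M * norm (F n - G) + M * norm (U \<bar>s n - t\<bar> G - U 0 G)" for n
  proof -
    have "U (s n) (F n) - U t G = U (s n) (F n - G) + (U (s n) G - U t G)"
      using bounded_linear[of "s n"] nonneg by (simp add: linear_simps)
    moreover have "norm (U (s n) (F n - G)) \<le> M * norm (F n - G)"
      using nonneg L by (intro M) auto
    moreover have "norm (U (s n) G - U t G) \<le> M * norm (U \<bar>s n - t\<bar> G - U 0 G)"
    proof (cases "s n \<le> t")
      case True
      then show ?thesis
        using orbit[of "s n" t G] nonneg tL by (simp add: norm_minus_commute[of "U (s n) G"])
    next
      case False
      then show ?thesis using orbit[of t "s n" G] nonneg L by simp
    qed
    ultimately show ?thesis by (smt (verit) norm_triangle_ineq)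
  qed
  have "((\<lambda>r. U r G) \<longlongrightarrow> U 0 G) (at 0 within {0..})"
  proof -
    have "at 0 within {0::real..} = at_right 0"
      unfolding at_within_def
      by (rule arg_cong2[where f = inf]) (auto intro!: arg_cong[where f = principal])
    then show ?thesis using right_continuous by simp
  qed
  then have "continuous (at 0 within {0..}) (\<lambda>r. U r G)"
    by (simp add: continuous_within)
  moreover have "(\<lambda>n. \<bar>s n - t\<bar>) \<longlonglongrightarrow> 0"
    using tendsto_rabs[OF tendsto_diff[OF st tendsto_const[of t]]] by simp
  ultimately have "(\<lambda>n. U \<bar>s n - t\<bar> G) \<longlonglongrightarrow> U 0 G"
    by (auto simp: continuous_within_sequentially comp_def)
  then have "(\<lambda>n. M * norm (F n - G) + M * norm (U \<bar>s n - t\<bar> G - U 0 G))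
      \<longlonglongrightarrow> M * norm (G - G) + M * norm (U 0 G - U 0 G)"
    by (intro tendsto_intros FG)
  then have "(\<lambda>n. U (s n) (F n) - U t G) \<longlonglongrightarrow> 0"
    by (intro Lim_null_comparison[OF always_eventually, rule_format, OF bound]) simp
  then show "(\<lambda>n. case u n of (s, F) \<Rightarrow> U s F) \<longlonglongrightarrow> (case a of (s, F) \<Rightarrow> U s F)"
    by (simp add: LIM_zero_iff s_def F_def t_def G_def case_prod_beta)
qed

end

section \<open>Linear Volterra equations\<close>

text \<open>The two regularity conditions differ because in a Duhamel integral \<open>x\<close> enters only through the
  strongly continuous semigroup, whereas \<open>s\<close> also enters through the potential, which is merely measurable.\<close>

locale volterra_kernel =
  fixes K :: "real \<Rightarrow> real \<Rightarrow> 'a::{banach, second_countable_topology} \<Rightarrow> 'a"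
    and L C :: real
  assumes C_pos: "C > 0"
    and linear: "0 \<le> s \<Longrightarrow> s \<le> x \<Longrightarrow> x \<le> L \<Longrightarrow> linear (K x s)"
    and bound: "0 \<le> s \<Longrightarrow> s \<le> x \<Longrightarrow> x \<le> L \<Longrightarrow> norm (K x s F) \<le> C * norm F"
    and measurable: "0 \<le> x \<Longrightarrow> x \<le> L \<Longrightarrow> continuous_on {0..L} \<psi> \<Longrightarrow>
      (\<lambda>s. K x s (\<psi> s)) \<in> borel_measurable (lebesgue_on {0..x})"
    and continuous: "0 \<le> s \<Longrightarrow> continuous_on {s..L} (\<lambda>x. K x s F)"
begin

definition volterra :: "(real \<Rightarrow> 'a) \<Rightarrow> real \<Rightarrow> 'a"
  where "volterra \<psi> x = (LINT s|lebesgue_on {0..x}. K x s (\<psi> s))"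

lemma integrable_kernel:
  assumes "0 \<le> x" "x \<le> L" "continuous_on {0..L} \<psi>"
  shows "integrable (lebesgue_on {0..x}) (\<lambda>s. K x s (\<psi> s))"
proof -
  have c: "continuous_on {0..x} (\<lambda>s. C * norm (\<psi> s))"
    using assms by (auto intro!: continuous_intros intro: continuous_on_subset)
  have "norm (K x s (\<psi> s)) \<le> norm (C * norm (\<psi> s))" if "s \<in> {0..x}" for s
    using bound[of s x "\<psi> s"] that assms C_pos by simp
  then show ?thesis
    by (intro Bochner_Integration.integrable_bound[OF continuous_imp_integrable_real[OF c]]
        measurable assms AE_I2) auto
qed

text \<open>Extended by 0 for \<open>s > x\<close>, the integrand at a point \<open>s\<close> is continuous in \<open>x\<close> except for a possible
  jump at \<open>x = s\<close>. So it converges for almost every \<open>s\<close> as \<open>x\<close> tends to \<open>a\<close>, and dominated convergence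
  applies.\<close>

lemma continuous_on_volterra:
  assumes \<psi>: "continuous_on {0..L} \<psi>"
  shows "continuous_on {0..L} (volterra \<psi>)"
proof (rule continuous_on_sequentiallyI)
  fix u a assume u: "\<forall>n. u n \<in> {0..L}" and a: "a \<in> {0..L}" and lim: "u \<longlonglongrightarrow> a"
  define k where "k x s = indicator {0..x} s *\<^sub>R K x s (\<psi> s)" for x s
  have meas: "k x \<in> borel_measurable lebesgue" if "x \<in> {0..L}" for x
    unfolding k_def
    using measurable[of x \<psi>] that \<psi> by (subst borel_measurable_restrict_space_iff[symmetric]) auto
  have eq: "volterra \<psi> x = integral\<^sup>L lebesgue (k x)" for x
    unfolding volterra_def k_def by (rule integral_restrict_space) auto
  define w where "w s = indicator {0..L} s *\<^sub>R (C * norm (\<psi> s))" for s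
  have "integrable (lebesgue_on {0..L}) (\<lambda>s. C * norm (\<psi> s))"
    using \<psi> by (intro continuous_imp_integrable_real continuous_intros)
  then have w: "integrable lebesgue w"
    unfolding w_def by (subst (asm) integrable_restrict_space) auto
  have dom: "norm (k x s) \<le> w s" if "x \<in> {0..L}" for x s
    using bound[of s x "\<psi> s"] that C_pos by (auto simp: k_def w_def indicator_def)
  have "(\<lambda>n. k (u n) s) \<longlonglongrightarrow> k a s" if "s \<noteq> a" for s
  proof (cases "0 \<le> s \<and> s < a")
    case True
    then have ev: "eventually (\<lambda>n. u n > s) sequentially"
      using order_tendstoD(1)[OF lim] by blast
    have "((\<lambda>x. K x s (\<psi> s)) \<longlongrightarrow> K a s (\<psi> s)) (at a within {s..L})"
      using continuous[of s "\<psi> s"] True a by (auto simp: continuous_on)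
    then have "continuous (at a within {s..L}) (\<lambda>x. K x s (\<psi> s))"
      by (simp add: continuous_within)
    moreover have "\<forall>\<^sub>F n in sequentially. u n \<in> {s..L}"
      using ev by eventually_elim (use u in auto)
    ultimately have "(\<lambda>n. K (u n) s (\<psi> s)) \<longlonglongrightarrow> K a s (\<psi> s)"
      using lim by (rule continuous_within_tendsto_compose)
    moreover have "eventually (\<lambda>n. K (u n) s (\<psi> s) = k (u n) s) sequentially"
      using ev by eventually_elim (use True in \<open>auto simp: k_def\<close>)
    ultimately have "(\<lambda>n. k (u n) s) \<longlonglongrightarrow> K a s (\<psi> s)" by (rule Lim_transform_eventually)
    then show ?thesis using True by (simp add: k_def)
  next
    case False
    then have "eventually (\<lambda>n. s \<notin> {0..u n}) sequentially"
    proof (cases "0 \<le> s")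
      case True
      then have "eventually (\<lambda>n. u n < s) sequentially"
        using order_tendstoD(2)[OF lim] False that by auto
      then show ?thesis by eventually_elim auto
    qed auto
    then have "eventually (\<lambda>n. 0 = k (u n) s) sequentially"
      by eventually_elim (simp add: k_def)
    then have "(\<lambda>n. k (u n) s) \<longlonglongrightarrow> 0" by (rule Lim_transform_eventually[OF tendsto_const])
    moreover have "k a s = 0" using False that by (auto simp: k_def indicator_def)
    ultimately show ?thesis by simp
  qed
  moreover have "AE s in lebesgue. s \<noteq> a"
    by (rule AE_completion, rule AE_lborel_singleton)
  ultimately have conv: "AE s in lebesgue. (\<lambda>n. k (u n) s) \<longlonglongrightarrow> k a s" by auto
  have "(\<lambda>n. integral\<^sup>L lebesgue (k (u n))) \<longlonglongrightarrow> integral\<^sup>L lebesgue (k a)"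
  proof (rule integral_dominated_convergence[where w = w])
    show "AE s in lebesgue. norm (k (u n) s) \<le> w s" for n
      using u by (intro AE_I2 dom) auto
  qed (use u a conv in \<open>auto intro: w meas\<close>)
  then show "(\<lambda>n. volterra \<psi> (u n)) \<longlonglongrightarrow> volterra \<psi> a" by (simp only: eq)
qed

lemma integral_exp_le:
  assumes "x \<ge> 0"
  shows "(LINT s|lebesgue_on {0..x}. exp (2 * C * s)) \<le> exp (2 * C * x) / (2 * C)"
proof -
  have "((\<lambda>s. exp (2 * C * s)) has_integral (exp (2 * C * x) / (2 * C) - exp (2 * C * 0) / (2 * C))) {0..x}"
    using assms C_pos
    by (intro fundamental_theorem_of_calculus)
      (auto intro!: derivative_eq_intros simp flip: has_real_derivative_iff_has_vector_derivative)
  moreover have "integrable (lebesgue_on {0..x}) (\<lambda>s. exp (2 * C * s))"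
    by (intro continuous_imp_integrable_real continuous_intros)
  ultimately have "(LINT s|lebesgue_on {0..x}. exp (2 * C * s)) = exp (2 * C * x) / (2 * C) - 1 / (2 * C)"
    by (simp add: lebesgue_integral_eq_integral integral_unique)
  then show ?thesis using C_pos by simp
qed

text \<open>In the norm weighted by \<open>exp (- 2 * C * x)\<close> the Volterra operator halves distances, however long
  the interval is: the rate \<open>2 * C\<close> is chosen so that integrating the weight gains the factor
  \<open>1 / (2 * C)\<close> while the kernel costs only \<open>C\<close>.\<close>

lemma volterra_contraction:
  assumes "continuous_on {0..L} \<psi>" "continuous_on {0..L} \<eta>"
    and d: "\<And>s. s \<in> {0..L} \<Longrightarrow> norm (\<psi> s - \<eta> s) \<le> d * exp (2 * C * s)"
    and x: "x \<in> {0..L}"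
  shows "norm (volterra \<psi> x - volterra \<eta> x) \<le> d / 2 * exp (2 * C * x)"
proof -
  have "norm (\<psi> x - \<eta> x) \<le> d * exp (2 * C * x)" by (rule d[OF x])
  then have d0: "d \<ge> 0" 
    by (meson exp_gt_zero norm_ge_zero order_trans zero_le_mult_iff not_le)
  have e: "integrable (lebesgue_on {0..x}) (\<lambda>s. C * d * exp (2 * C * s))"
    by (intro continuous_imp_integrable_real continuous_intros)
  have "volterra \<psi> x - volterra \<eta> x = (LINT s|lebesgue_on {0..x}. K x s (\<psi> s) - K x s (\<eta> s))"
    unfolding volterra_def using assms integrable_kernel[of x]
    by (subst Bochner_Integration.integral_diff) auto
  also have "norm \<dots> \<le> (LINT s|lebesgue_on {0..x}. C * d * exp (2 * C * s))"
  proof (rule Bochner_Integration.integral_norm_bound_integral)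
    show "integrable (lebesgue_on {0..x}) (\<lambda>s. K x s (\<psi> s) - K x s (\<eta> s))"
      using assms integrable_kernel[of x] by auto
    fix s assume "s \<in> space (lebesgue_on {0..x})"
    then have s: "0 \<le> s" "s \<le> x" "x \<le> L" "s \<in> {0..L}" using x by auto
    have "K x s (\<psi> s) - K x s (\<eta> s) = K x s (\<psi> s - \<eta> s)"
      using linear[of s x] s by (simp add: linear_diff)
    then have "norm (K x s (\<psi> s) - K x s (\<eta> s)) \<le> C * norm (\<psi> s - \<eta> s)"
      using bound[of s x] s by simp
    also have "\<dots> \<le> C * (d * exp (2 * C * s))"
      using d[OF s(4)] C_pos by (intro mult_left_mono) auto
    finally show "norm (K x s (\<psi> s) - K x s (\<eta> s)) \<le> C * d * exp (2 * C * s)" by simp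
  qed (rule e)
  also have "\<dots> = C * d * (LINT s|lebesgue_on {0..x}. exp (2 * C * s))" by simp
  also have "\<dots> \<le> C * d * (exp (2 * C * x) / (2 * C))"
    using C_pos d0 integral_exp_le[of x] x by (intro mult_left_mono) auto
  also have "\<dots> = d / 2 * exp (2 * C * x)" using C_pos by simp
  finally show ?thesis .
qed

text \<open>The difference of two solutions is its own image under the contraction, so its weighted norm is
  below \<open>d / 2 ^ n\<close> for every \<open>n\<close>.\<close>

lemma volterra_unique:
  assumes "continuous_on {0..L} \<psi>" "continuous_on {0..L} \<eta>"
    and \<psi>: "\<And>x. x \<in> {0..L} \<Longrightarrow> \<psi> x = \<phi> x + volterra \<psi> x"
    and \<eta>: "\<And>x. x \<in> {0..L} \<Longrightarrow> \<eta> x = \<phi> x + volterra \<eta> x"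
    and x: "x \<in> {0..L}"
  shows "\<psi> x = \<eta> x"
proof -
  have "bounded ((\<lambda>s. \<psi> s - \<eta> s) ` {0..L})"
    using assms by (intro compact_imp_bounded compact_continuous_image continuous_intros) auto
  then obtain d where d: "\<And>s. s \<in> {0..L} \<Longrightarrow> norm (\<psi> s - \<eta> s) \<le> d"
    unfolding bounded_iff by blast
  have d0: "0 \<le> d" by (rule order_trans[OF norm_ge_zero d[OF x]])
  have it: "norm (\<psi> s - \<eta> s) \<le> d / 2 ^ n * exp (2 * C * s)" if "s \<in> {0..L}" for n s
    using that
  proof (induction n arbitrary: s)
    case 0
    have "d * 1 \<le> d * exp (2 * C * s)" using d0 0 C_pos by (intro mult_left_mono) auto
    then show ?case using d[OF 0] by simp
  next
    case (Suc n)
    have "\<psi> s - \<eta> s = volterra \<psi> s - volterra \<eta> s"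
      using \<psi>[OF Suc.prems] \<eta>[OF Suc.prems] by (metis add_diff_cancel_left)
    then show ?case
      using volterra_contraction[OF assms(1,2) Suc.IH Suc.prems] by (simp add: mult.commute)
  qed
  have "(\<lambda>n. d * (1/2) ^ n * exp (2 * C * x)) \<longlonglongrightarrow> d * 0 * exp (2 * C * x)"
    by (intro tendsto_intros LIMSEQ_realpow_zero) auto
  then have "norm (\<psi> x - \<eta> x) \<le> 0"
    using it[OF x] by (intro LIMSEQ_le_const) (auto simp: power_divide)
  then show ?thesis by simp
qed

text \<open>The Picard iterates \<open>p n\<close> have geometrically decreasing increments, so they converge uniformly;
  the contraction estimate also shows that the limit solves the equation.\<close>

lemma volterra_solvable:
  assumes \<phi>: "continuous_on {0..L} \<phi>"
  shows "\<exists>\<psi>. continuous_on {0..L} \<psi> \<and> (\<forall>x\<in>{0..L}. \<psi> x = \<phi> x + volterra \<psi> x)"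
proof -
  define p where "p = rec_nat \<phi> (\<lambda>_ \<psi> x. \<phi> x + volterra \<psi> x)"
  have p_0: "p 0 = \<phi>" and p_Suc: "p (Suc n) = (\<lambda>x. \<phi> x + volterra (p n) x)" for n
    by (simp_all add: p_def)
  have cont: "continuous_on {0..L} (p n)" for n
    by (induction n) (auto simp: p_0 p_Suc \<phi> intro!: continuous_intros continuous_on_volterra)
  have "bounded ((\<lambda>s. p 1 s - p 0 s) ` {0..L})"
    by (intro compact_imp_bounded compact_continuous_image continuous_intros cont) auto
  then obtain d where d: "d > 0" "\<And>s. s \<in> {0..L} \<Longrightarrow> norm (p 1 s - p 0 s) \<le> d"
    by (auto simp: bounded_pos)
  have step: "norm (p (Suc n) s - p n s) \<le> d / 2 ^ n * exp (2 * C * s)" if "s \<in> {0..L}" for n s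
    using that
  proof (induction n arbitrary: s)
    case 0
    have "d * 1 \<le> d * exp (2 * C * s)" using d 0 C_pos by (intro mult_left_mono) auto
    then show ?case using d(2)[OF 0] by simp
  next
    case (Suc n)
    have "p (Suc (Suc n)) s - p (Suc n) s = volterra (p (Suc n)) s - volterra (p n) s"
      by (simp add: p_Suc)
    then show ?case
      using volterra_contraction[OF cont cont Suc.IH Suc.prems] by (simp add: mult.commute)
  qed
  define E where "E = exp (2 * C * L)"
  have step': "norm (p (Suc n) s - p n s) \<le> d * E * (1/2) ^ n" if "s \<in> {0..L}" for n s
  proof -
    have "exp (2 * C * s) \<le> E" using that C_pos by (simp add: E_def)
    then have "d / 2 ^ n * exp (2 * C * s) \<le> d / 2 ^ n * E" using d by (intro mult_left_mono) auto
    then show ?thesis using step[OF that, of n] by (simp add: power_divide)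
  qed
  have "uniform_limit {0..L} (\<lambda>n s. \<Sum>i<n. p (Suc i) s - p i s) (\<lambda>s. \<Sum>i. p (Suc i) s - p i s) sequentially"
    by (rule Weierstrass_m_test[OF step']) (auto intro!: summable_mult summable_geometric)
  then have ul: "uniform_limit {0..L} (\<lambda>n s. p n s - p 0 s) (\<lambda>s. \<Sum>i. p (Suc i) s - p i s) sequentially"
    by (simp only: sum_lessThan_telescope[of "\<lambda>i. p i s" for s])
  define q where "q s = p 0 s + (\<Sum>i. p (Suc i) s - p i s)" for s
  have "uniform_limit {0..L} (\<lambda>n s. p 0 s + (p n s - p 0 s)) q sequentially"
    unfolding q_def[abs_def] by (intro uniform_limit_add uniform_limit_const ul)
  then have ul: "uniform_limit {0..L} p q sequentially" by simp
  have cq: "continuous_on {0..L} q"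
    by (rule uniform_limit_theorem[OF _ ul]) (simp_all add: cont)
  have "q x = \<phi> x + volterra q x" if x: "x \<in> {0..L}" for x
  proof -
    have "(\<lambda>n. volterra (p n) x) \<longlonglongrightarrow> volterra q x"
    proof (rule tendstoI)
      fix e :: real assume e: "e > 0"
      define e' where "e' = e / exp (2 * C * x)"
      have e': "e' > 0" using e by (simp add: e'_def)
      have "\<forall>\<^sub>F n in sequentially. \<forall>s\<in>{0..L}. dist (p n s) (q s) < e'"
        using ul e' by (simp add: uniform_limit_iff)
      then show "\<forall>\<^sub>F n in sequentially. dist (volterra (p n) x) (volterra q x) < e"
      proof eventually_elim
        case (elim n)
        have "norm (p n s - q s) \<le> e' * exp (2 * C * s)" if "s \<in> {0..L}" for s
        proof -
          have "e' * 1 \<le> e' * exp (2 * C * s)" using that C_pos e' by (intro mult_left_mono) auto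
          then show ?thesis using elim that by (force simp: dist_norm)
        qed
        from volterra_contraction[OF cont cq this x]
        have "norm (volterra (p n) x - volterra q x) \<le> e' / 2 * exp (2 * C * x)" .
        also have "\<dots> = e / 2" by (simp add: e'_def)
        finally show ?case using e by (simp add: dist_norm)
      qed
    qed
    then have "(\<lambda>n. p (Suc n) x) \<longlonglongrightarrow> \<phi> x + volterra q x"
      unfolding p_Suc by (intro tendsto_intros)
    moreover have "(\<lambda>n. p (Suc n) x) \<longlonglongrightarrow> q x"
      using tendsto_uniform_limitI[OF ul x] by (rule LIMSEQ_Suc)
    ultimately show ?thesis by (metis LIMSEQ_unique)
  qed
  then show ?thesis using cq by blast
qed

end

section \<open>Measurability\<close>

text \<open>In a separable space every open set is a countable union of balls, and the hypothesis says
  that the preimages of balls are measurable.\<close>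

lemma borel_measurable_if_norm_diff:
  fixes h :: "'m \<Rightarrow> 'a::{real_normed_vector, second_countable_topology}"
  assumes "\<And>d. (\<lambda>x. norm (h x - d)) \<in> borel_measurable M"
  shows "h \<in> borel_measurable M"
proof (rule borel_measurableI)
  fix S :: "'a set" assume S: "open S"
  obtain D :: "'a set" where D: "countable D" "\<And>X. open X \<Longrightarrow> X \<noteq> {} \<Longrightarrow> \<exists>d\<in>D. d \<in> X"
    by (erule countable_dense_setE)
  define I where "I = {(d, n). d \<in> D \<and> ball d (inverse (real (Suc n))) \<subseteq> S}"
  have "I \<subseteq> D \<times> UNIV" by (auto simp: I_def)
  then have I: "countable I" by (rule countable_subset) (intro countable_SIGMA countableI_type D(1))
  have "x \<in> (\<Union>p\<in>I. ball (fst p) (inverse (real (Suc (snd p)))))" if x: "x \<in> S" for x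
  proof -
    obtain e where e: "e > 0" "ball x e \<subseteq> S" by (rule openE[OF S x])
    obtain n where n: "inverse (real (Suc n)) < e / 2" using reals_Archimedean[of "e / 2"] e by auto
    obtain d where d: "d \<in> D" "d \<in> ball x (inverse (real (Suc n)))"
      using D(2)[of "ball x (inverse (real (Suc n)))"] by auto
    have "ball d (inverse (real (Suc n))) \<subseteq> ball x e"
    proof
      fix z assume "z \<in> ball d (inverse (real (Suc n)))"
      then show "z \<in> ball x e" using dist_triangle[of x z d] d(2) n by simp
    qed
    then have "(d, n) \<in> I" using e d by (auto simp: I_def)
    then show ?thesis using d(2) by (intro UN_I[of "(d, n)"]) (auto simp: dist_commute)
  qed
  then have S_eq: "S = (\<Union>p\<in>I. ball (fst p) (inverse (real (Suc (snd p)))))"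
    by (auto simp: I_def)
  have "h -` S \<inter> space M = (\<Union>p\<in>I. {x\<in>space M. norm (h x - fst p) < inverse (real (Suc (snd p)))})"
  proof -
    have "h x \<in> S \<longleftrightarrow> (\<exists>p\<in>I. norm (h x - fst p) < inverse (real (Suc (snd p))))" for x
      by (subst S_eq) (simp add: dist_norm norm_minus_commute)
    then show ?thesis by blast
  qed
  moreover have "{x\<in>space M. norm (h x - d) < inverse (real (Suc n))} \<in> sets M" for d n
    using assms[of d] by measurable
  ultimately show "h -` S \<inter> space M \<in> sets M"
    using I by (auto intro!: sets.countable_UN')
qed

lemma norm_le_iff_inner_dense:
  fixes v :: "'a::real_inner"
  assumes D: "\<And>X. open X \<Longrightarrow> X \<noteq> {} \<Longrightarrow> \<exists>d\<in>D. d \<in> X" and "r \<ge> 0"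
  shows "norm v \<le> r \<longleftrightarrow> (\<forall>e\<in>D. v \<bullet> e \<le> r * norm e)"
proof (intro iffI ballI)
  fix e assume "norm v \<le> r"
  then show "v \<bullet> e \<le> r * norm e"
    using norm_cauchy_schwarz[of v e] mult_right_mono[of "norm v" r "norm e"] by simp
next
  assume le: "\<forall>e\<in>D. v \<bullet> e \<le> r * norm e"
  have "open {e. r * norm e < v \<bullet> e}"
    by (intro open_Collect_less continuous_intros)
  then have "{e. r * norm e < v \<bullet> e} = {}" using D[of "{e. r * norm e < v \<bullet> e}"] le by force
  then have "v \<bullet> v \<le> r * norm v" by (simp add: not_less)
  then show "norm v \<le> r"
    using \<open>r \<ge> 0\<close> by (cases "v = 0") (auto simp: power2_norm_eq_inner[symmetric] power2_eq_square)
qed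

text \<open>This is Pettis' theorem for separable inner product spaces: closed balls are countable
  intersections of half-spaces, so measurability may be tested against fixed vectors.\<close>

lemma borel_measurable_if_inner:
  fixes h :: "'m \<Rightarrow> 'a::{real_inner, second_countable_topology}"
  assumes weak: "\<And>e. (\<lambda>x. h x \<bullet> e) \<in> borel_measurable M"
  shows "h \<in> borel_measurable M"
proof (rule borel_measurable_if_norm_diff, subst borel_measurable_iff_le, rule allI)
  fix d :: 'a and r
  obtain D :: "'a set" where D: "countable D" "\<And>X. open X \<Longrightarrow> X \<noteq> {} \<Longrightarrow> \<exists>d\<in>D. d \<in> X"
    by (erule countable_dense_setE)
  show "{x\<in>space M. norm (h x - d) \<le> r} \<in> sets M"
  proof (cases "r \<ge> 0")
    case True
    have "{x\<in>space M. norm (h x - d) \<le> r} = {x\<in>space M. \<forall>e\<in>D. (h x - d) \<bullet> e \<le> r * norm e}"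
      using norm_le_iff_inner_dense[OF D(2) True] by blast
    also have "\<dots> = {x\<in>space M. \<forall>e\<in>D. h x \<bullet> e - d \<bullet> e \<le> r * norm e}"
      by (simp add: inner_diff_left)
    also have "\<dots> \<in> sets M"
    proof (rule sets.sets_Collect_countable_All'[OF _ D(1)])
      show "{x\<in>space M. h x \<bullet> e - d \<bullet> e \<le> r * norm e} \<in> sets M" for e
        using weak[of e] by measurable
    qed
    finally show ?thesis .
  next
    case False
    then have "\<not> norm (h x - d) \<le> r" for x using norm_ge_zero[of "h x - d"] by linarith
    then show ?thesis by simp
  qed
qed

lemma sigma_finite_lebesgue: "sigma_finite_measure (lebesgue :: 'a::euclidean_space measure)"
proof
  obtain A :: "'a set set" where "countable A" "A \<subseteq> sets lborel" "\<Union>A = space lborel"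
      "\<forall>a\<in>A. emeasure lborel a \<noteq> \<infinity>"
    using lborel.sigma_finite_countable by blast
  then show "\<exists>A. countable A \<and> A \<subseteq> sets lebesgue \<and> \<Union>A = space lebesgue \<and>
      (\<forall>a\<in>A. emeasure lebesgue (a::'a set) \<noteq> \<infinity>)"
    by (intro exI[of _ A]) (auto simp: subset_iff)
qed

lemma measurable_completion_AE:
  assumes f: "f \<in> completion M \<rightarrow>\<^sub>M N" and ae: "AE x in completion M. f x = g x"
    and g: "g \<in> space M \<rightarrow> space N"
  shows "g \<in> completion M \<rightarrow>\<^sub>M N"
proof (rule measurableI)
  fix A assume A: "A \<in> sets N"
  show "g -` A \<inter> space (completion M) \<in> sets (completion M)"
  proof (rule completion.in_sets_AE)
    show "f -` A \<inter> space (completion M) \<in> sets (completion M)"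
      using f A by (rule measurable_sets)
    show "AE x in completion M. x \<in> f -` A \<inter> space (completion M) \<longleftrightarrow> x \<in> g -` A \<inter> space (completion M)"
      using ae by eventually_elim auto
  qed auto
qed (use g in auto)

text \<open>Measurability of \<open>g\<close> is a consequence: Lebesgue measure is complete, whatever the codomain.\<close>

lemma integral_lebesgue_on_cong_AE:
  fixes f :: "'a::euclidean_space \<Rightarrow> 'b::{banach, second_countable_topology}"
  assumes f: "integrable (lebesgue_on S) f" and S: "S \<in> sets lebesgue"
    and ae: "AE x in lebesgue. x \<in> S \<longrightarrow> f x = g x"
  shows "integrable (lebesgue_on S) g" "(LINT x|lebesgue_on S. g x) = (LINT x|lebesgue_on S. f x)"
proof -
  have int: "integrable lebesgue (\<lambda>x. indicator S x *\<^sub>R f x)"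
    using f S by (simp add: integrable_restrict_space)
  have ae': "AE x in lebesgue. indicator S x *\<^sub>R f x = indicator S x *\<^sub>R g x"
    using ae by eventually_elim (auto simp: indicator_def)
  have meas: "(\<lambda>x. indicator S x *\<^sub>R g x) \<in> borel_measurable lebesgue"
    by (rule measurable_completion_AE[OF borel_measurable_integrable[OF int] ae']) auto
  have "integrable lebesgue (\<lambda>x. indicator S x *\<^sub>R g x)"
    using int integrable_cong_AE[OF borel_measurable_integrable[OF int] meas ae'] by simp
  then show "integrable (lebesgue_on S) g" using S by (simp add: integrable_restrict_space)
  show "(LINT x|lebesgue_on S. g x) = (LINT x|lebesgue_on S. f x)"
    using S integral_cong_AE[OF borel_measurable_integrable[OF int] meas ae']
    by (simp add: integral_restrict_space)
qed

section \<open>Multiplication operators\<close>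

lemma norm_vector_scalar_mult: "norm (c *s v) = norm c * norm v" for v :: "complex^2"
proof -
  have "norm (c *s v) = sqrt ((norm c)\<^sup>2 * ((norm (v $ 1))\<^sup>2 + (norm (v $ 2))\<^sup>2))"
    by (simp add: norm_vec_def L2_set_def sum_2 norm_mult power_mult_distrib algebra_simps)
  then show ?thesis by (simp add: real_sqrt_mult norm_vec_def L2_set_def sum_2)
qed

lemma inner_vector_scalar_mult: "(c *s v) \<bullet> w = v \<bullet> (cnj c *s w)" for v :: "complex^2"
  by (simp add: inner_vec_def sum_2 inner_complex_def algebra_simps)

lemma borel_measurable_vector_scalar_mult [measurable]:
  fixes f :: "'m \<Rightarrow> complex^2"
  assumes "c \<in> borel_measurable M" "f \<in> borel_measurable M"
  shows "(\<lambda>x. c x *s f x) \<in> borel_measurable M"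
proof (rule borel_measurable_continuous_Pair[OF assms])
  show "continuous_on UNIV (\<lambda>p::complex \<times> (complex^2). fst p *s snd p)"
    unfolding vector_scalar_mult_def by (intro continuous_intros)
qed

text \<open>Square-integrability of the second function is a conclusion: it lets expressions such as the
  potential term, whose integrability is not known in advance, be replaced by well-behaved ones.\<close>

lemma L2_class_cong_AE:
  assumes "square_integrable f" "AE y in lebesgue. f y = g y"
  shows "square_integrable g" "L2_class f = L2_class g"
proof -
  have g: "g \<in> borel_measurable lebesgue"
    using assms by (auto intro: borel_measurable_AE simp: square_integrable_def)
  have "integrable lebesgue (\<lambda>y. (norm (f y))\<^sup>2) \<longleftrightarrow> integrable lebesgue (\<lambda>y. (norm (g y))\<^sup>2)"
    using assms g by (intro integrable_cong_AE) (auto simp: square_integrable_def)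
  then show "square_integrable g" using assms g by (simp add: square_integrable_def)
  then show "L2_class f = L2_class g" using assms by (simp add: L2_class_eq_iff)
qed

lemma inner_L2_class:
  "square_integrable f \<Longrightarrow> square_integrable g \<Longrightarrow> L2_class f \<bullet> L2_class g = (LINT y|lebesgue. f y \<bullet> g y)"
  by (simp add: L2_class_def inner_L2.abs_eq L2_rel_def)

lemma L2_class_scaleR: "square_integrable f \<Longrightarrow> c *\<^sub>R L2_class f = L2_class (\<lambda>y. c *\<^sub>R f y)"
  by (simp add: L2_class_def square_integrable_scaleR scaleR_L2.abs_eq L2_rel_def)

lemma rep_L2_plus: "AE y in lebesgue. rep_L2 (F + G) y = rep_L2 F y + rep_L2 G y"
  using rep_L2_class[OF square_integrable_add[of "rep_L2 F" "rep_L2 G"]]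
  by (simp add: L2_class_add[symmetric])

lemma rep_L2_scaleR: "AE y in lebesgue. rep_L2 (c *\<^sub>R F) y = c *\<^sub>R rep_L2 F y"
  using rep_L2_class[OF square_integrable_scaleR[of "rep_L2 F" c]]
  by (simp add: L2_class_scaleR[symmetric])

definition mult_L2 :: "(real \<Rightarrow> complex) \<Rightarrow> L2 \<Rightarrow> L2"
  where "mult_L2 w F = L2_class (\<lambda>y. w y *s rep_L2 F y)"

locale multiplier =
  fixes w :: "real \<Rightarrow> complex" and C :: real
  assumes measurable: "w \<in> borel_measurable lebesgue"
    and bound: "norm (w y) \<le> C"
begin

lemma C_nonneg: "0 \<le> C"
  using order_trans[OF norm_ge_zero bound] .

lemma norm_le: "(norm (w y *s v))\<^sup>2 \<le> C\<^sup>2 * (norm v)\<^sup>2" for v :: "complex^2"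
proof -
  have "norm (w y *s v) \<le> C * norm v"
    unfolding norm_vector_scalar_mult by (intro mult_right_mono bound norm_ge_zero)
  from power_mono[OF this norm_ge_zero, of 2] show ?thesis by (simp add: power_mult_distrib)
qed

lemma square_integrable_mult:
  assumes f: "square_integrable f"
  shows "square_integrable (\<lambda>y. w y *s f y)"
  unfolding square_integrable_def
proof
  show meas: "(\<lambda>y. w y *s f y) \<in> borel_measurable lebesgue"
    using f measurable by (intro borel_measurable_vector_scalar_mult) (auto simp: square_integrable_def)
  have "integrable lebesgue (\<lambda>y. C\<^sup>2 * (norm (f y))\<^sup>2)"
    using f by (simp add: square_integrable_def)
  then show "integrable lebesgue (\<lambda>y. (norm (w y *s f y))\<^sup>2)"
    by (rule Bochner_Integration.integrable_bound) (use meas norm_le in auto)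
qed

lemma norm_mult_L2: "norm (mult_L2 w F) \<le> C * norm F"
proof -
  have "integrable lebesgue (\<lambda>y. (norm (w y *s rep_L2 F y))\<^sup>2)"
    using square_integrable_mult[OF square_integrable_rep_L2[of F]] by (simp add: square_integrable_def)
  moreover have int: "integrable lebesgue (\<lambda>y. C\<^sup>2 * (norm (rep_L2 F y))\<^sup>2)"
    using square_integrable_rep_L2[of F] unfolding square_integrable_def by simp
  ultimately have "(LINT y|lebesgue. (norm (w y *s rep_L2 F y))\<^sup>2)
      \<le> (LINT y|lebesgue. C\<^sup>2 * (norm (rep_L2 F y))\<^sup>2)"
    by (rule integral_mono) (rule norm_le)
  then have "norm (mult_L2 w F) \<le> sqrt (C\<^sup>2 * (LINT y|lebesgue. (norm (rep_L2 F y))\<^sup>2))"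
    unfolding mult_L2_def norm_L2_class[OF square_integrable_mult[OF square_integrable_rep_L2]]
    by (intro real_sqrt_le_mono) simp
  then show ?thesis
    using norm_L2_class[OF square_integrable_rep_L2[of F]] C_nonneg by (simp add: real_sqrt_mult)
qed

lemma bounded_linear_mult_L2: "bounded_linear (mult_L2 w)"
proof (rule bounded_linear_intro[where K = C])
  fix F G :: L2 and c :: real
  have "L2_class (\<lambda>y. w y *s rep_L2 F y + w y *s rep_L2 G y) = mult_L2 w (F + G)"
    unfolding mult_L2_def
  proof (rule L2_class_cong_AE)
    show "AE y in lebesgue. w y *s rep_L2 F y + w y *s rep_L2 G y = w y *s rep_L2 (F + G) y"
      using rep_L2_plus[of F G] by eventually_elim (simp add: vec.scale_right_distrib)
  qed (intro square_integrable_add square_integrable_mult square_integrable_rep_L2)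
  then show "mult_L2 w (F + G) = mult_L2 w F + mult_L2 w G"
    by (simp add: mult_L2_def L2_class_add square_integrable_mult)
  have "L2_class (\<lambda>y. c *\<^sub>R (w y *s rep_L2 F y)) = mult_L2 w (c *\<^sub>R F)"
    unfolding mult_L2_def
  proof (rule L2_class_cong_AE)
    show "AE y in lebesgue. c *\<^sub>R (w y *s rep_L2 F y) = w y *s rep_L2 (c *\<^sub>R F) y"
      using rep_L2_scaleR[of c F] by eventually_elim (simp add: vec_eq_iff)
  qed (intro square_integrable_scaleR square_integrable_mult square_integrable_rep_L2)
  then show "mult_L2 w (c *\<^sub>R F) = c *\<^sub>R mult_L2 w F"
    by (simp add: mult_L2_def L2_class_scaleR square_integrable_mult)
  show "norm (mult_L2 w F) \<le> norm F * C" using norm_mult_L2[of F] by (simp add: mult.commute)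
qed

lemma inner_mult_L2: "mult_L2 w F \<bullet> G = (LINT y|lebesgue. (w y *s rep_L2 F y) \<bullet> rep_L2 G y)"
  using inner_L2_class[OF square_integrable_mult[OF square_integrable_rep_L2[of F]]
      square_integrable_rep_L2[of G]] by (simp add: mult_L2_def)

lemma rep_mult_L2: "AE y in lebesgue. rep_L2 (mult_L2 w F) y = w y *s rep_L2 F y"
  unfolding mult_L2_def by (intro rep_L2_class square_integrable_mult square_integrable_rep_L2)

lemma multiplier_cnj: "multiplier (\<lambda>y. cnj (w y)) C"
proof
  show "(\<lambda>y. cnj (w y)) \<in> borel_measurable lebesgue"
    using borel_measurable_continuous_on[OF _ measurable, of cnj] by (simp add: continuous_intros)
qed (simp add: bound)

lemma mult_L2_adjoint: "mult_L2 w F \<bullet> G = F \<bullet> mult_L2 (\<lambda>y. cnj (w y)) G"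
proof -
  have "F \<bullet> mult_L2 (\<lambda>y. cnj (w y)) G = (LINT y|lebesgue. (cnj (w y) *s rep_L2 G y) \<bullet> rep_L2 F y)"
    unfolding inner_commute[of F] by (rule multiplier.inner_mult_L2[OF multiplier_cnj])
  then show ?thesis
    by (simp add: inner_mult_L2 inner_vector_scalar_mult inner_commute[of "rep_L2 F _"])
qed

end

section \<open>Measurable families of multiplication operators\<close>

locale multiplier_family =
  fixes W :: "real \<times> real \<Rightarrow> complex" and C :: real
  assumes borel: "W \<in> borel_measurable borel"
    and bound: "norm (W p) \<le> C"
begin

lemma multiplier: "multiplier (\<lambda>y. W (x, y)) C"
proof
  have "(\<lambda>y. W (x, y)) \<in> borel_measurable borel"
    by (rule measurable_compose[OF _ borel]) (intro borel_measurable_continuous_onI continuous_intros)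
  then show "(\<lambda>y. W (x, y)) \<in> borel_measurable lebesgue"
    by (simp add: measurable_completion)
qed (rule bound)

text \<open>Against a fixed field the product is an integral over \<open>y\<close> of a jointly measurable function, so
  Fubini's theorem gives weak measurability in \<open>x\<close>, and weak measurability suffices.\<close>

lemma borel_measurable_mult_const: "(\<lambda>x. mult_L2 (\<lambda>y. W (x, y)) F) \<in> borel_measurable borel"
proof (rule borel_measurable_if_inner)
  fix G
  interpret sigma_finite_measure "lebesgue :: real measure" by (rule sigma_finite_lebesgue)
  have fst_snd: "(\<lambda>p. (fst p, snd p)) \<in> borel \<Otimes>\<^sub>M (lebesgue::real measure) \<rightarrow>\<^sub>M borel \<Otimes>\<^sub>M (borel::real measure)"
  proof (rule measurable_Pair)
    show "snd \<in> borel \<Otimes>\<^sub>M (lebesgue::real measure) \<rightarrow>\<^sub>M borel"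
      by (rule measurable_compose[OF measurable_snd id_borel_measurable_lebesgue[unfolded id_def]])
  qed (rule measurable_fst)
  then have "W \<in> borel_measurable (borel \<Otimes>\<^sub>M lebesgue)"
    using measurable_compose[OF fst_snd borel[unfolded borel_prod[symmetric]]] by simp
  moreover have "(\<lambda>p. rep_L2 H (snd p)) \<in> borel_measurable (borel \<Otimes>\<^sub>M lebesgue)" for H
    using square_integrable_rep_L2[of H]
    by (intro measurable_compose[OF measurable_snd]) (simp add: square_integrable_def)
  ultimately have "(\<lambda>(x, y). (W (x, y) *s rep_L2 F y) \<bullet> rep_L2 G y) \<in> borel_measurable (borel \<Otimes>\<^sub>M lebesgue)"
    unfolding case_prod_beta prod.collapse
    by (intro borel_measurable_inner borel_measurable_vector_scalar_mult)
  from borel_measurable_lebesgue_integral[OF this]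
  show "(\<lambda>x. mult_L2 (\<lambda>y. W (x, y)) F \<bullet> G) \<in> borel_measurable borel"
    by (simp only: multiplier.inner_mult_L2[OF multiplier])
qed

lemma multiplier_family_cnj: "multiplier_family (\<lambda>p. cnj (W p)) C"
proof
  show "(\<lambda>p. cnj (W p)) \<in> borel_measurable borel"
    using borel_measurable_continuous_on[OF _ borel, of cnj] by (simp add: continuous_intros)
qed (simp add: bound)

text \<open>Moving the multiplier to the other side of the inner product leaves the inner product of the
  measurable functions \<open>\<psi>\<close> and \<open>x \<mapsto> mult_L2 (cnj W(x, \<cdot>)) G\<close>; the latter falls under the case of a
  fixed field.\<close>

lemma borel_measurable_mult:
  assumes \<psi>: "\<psi> \<in> borel_measurable M" and id: "(\<lambda>x. x) \<in> borel_measurable M"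
  shows "(\<lambda>x. mult_L2 (\<lambda>y. W (x, y)) (\<psi> x)) \<in> borel_measurable M"
proof (rule borel_measurable_if_inner)
  fix G
  have "(\<lambda>x. mult_L2 (\<lambda>y. cnj (W (x, y))) G) \<in> borel_measurable M"
    using measurable_compose[OF id multiplier_family.borel_measurable_mult_const[OF multiplier_family_cnj]] .
  then show "(\<lambda>x. mult_L2 (\<lambda>y. W (x, y)) (\<psi> x) \<bullet> G) \<in> borel_measurable M"
    using \<psi> by (simp only: multiplier.mult_L2_adjoint[OF multiplier] borel_measurable_inner)
qed

end

lemma borel_version_complex:
  fixes f :: "'a::euclidean_space \<Rightarrow> complex"
  assumes f: "f \<in> borel_measurable lebesgue"
  shows "\<exists>g\<in>borel_measurable borel. AE x in lborel. f x = g x"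
proof -
  have "(\<lambda>x. Re (f x)) \<in> borel_measurable lebesgue" "(\<lambda>x. Im (f x)) \<in> borel_measurable lebesgue"
    using f by auto
  then obtain r i where r: "r \<in> borel_measurable lborel" "AE x in lborel. Re (f x) = r x"
      and i: "i \<in> borel_measurable lborel" "AE x in lborel. Im (f x) = i x"
    using completion_ex_borel_measurable_real by metis
  have "(\<lambda>x. Complex (r x) (i x)) \<in> borel_measurable borel"
    using r i unfolding Complex_eq by simp
  moreover have "AE x in lborel. f x = Complex (r x) (i x)"
    using r(2) i(2) by eventually_elim (simp add: complex_eq_iff)
  ultimately show ?thesis by (intro bexI[of _ "\<lambda>x. Complex (r x) (i x)"])
qed

text \<open>A Borel function that agrees with \<open>c * V\<close> almost everywhere in the rectangle is cut off where it
  exceeds the essential bound and for \<open>y\<close> outside the open interval. This makes all its slices bounded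
  and measurable, while by Fubini almost every slice still agrees with that of \<open>c * V\<close>. Vanishing
  outside the interval keeps the products in the subspace of fields supported there.\<close>

lemma L_infinity_borel_version:
  fixes V :: "real \<times> real \<Rightarrow> complex"
  assumes V: "L_infinity ({0..a} \<times> {0..b}) V"
  shows "\<exists>W C. multiplier_family W C \<and> (\<forall>x y. y \<notin> {0<..<b} \<longrightarrow> W (x, y) = 0) \<and>
    (AE x in lebesgue. x \<in> {0..a} \<longrightarrow> (AE y in lebesgue. y \<in> {0<..<b} \<longrightarrow> W (x, y) = c * V (x, y)))"
proof -
  let ?S = "{0..a} \<times> {0..b}"
  have S: "?S \<in> sets lebesgue" by (intro sets_completionI_sets) (simp add: borel_closed closed_Times)
  obtain C0 where C0: "AE p in lebesgue_on ?S. norm (V p) \<le> C0"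
    using V by (auto simp: L_infinity_def)
  define C where "C = norm c * \<bar>C0\<bar>"
  have "(\<lambda>p. if p \<in> ?S then V p else 0) \<in> borel_measurable lebesgue"
    using V S by (intro borel_measurable_if_I) (auto simp: L_infinity_def)
  then obtain g where g: "g \<in> borel_measurable borel"
      and Vg: "AE p in lborel. (if p \<in> ?S then V p else 0) = g p"
    using borel_version_complex by blast
  define W where "W p = (if snd p \<in> {0<..<b} \<and> norm (c * g p) \<le> C then c * g p else 0)" for p
  have "W \<in> borel_measurable borel"
  proof -
    have snd: "(snd :: real \<times> real \<Rightarrow> real) \<in> borel_measurable borel"
      by (intro borel_measurable_continuous_onI continuous_intros)
    have "{p :: real \<times> real. snd p \<in> {0<..<b}} \<in> sets borel"
      using measurable_sets[OF snd, of "{0<..<b}"] by (simp add: vimage_def)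
    moreover have "{p. norm (c * g p) \<le> C} \<in> sets borel"
      using g by measurable
    ultimately have "{p. snd p \<in> {0<..<b} \<and> norm (c * g p) \<le> C} \<in> sets borel"
      by (metis Collect_conj_eq sets.Int)
    then show ?thesis
      unfolding W_def using g by (intro measurable_If) auto
  qed
  moreover have "norm (W p) \<le> C" for p by (auto simp: W_def C_def)
  ultimately have fam: "multiplier_family W C" by unfold_locales
  have "AE p in lborel. p \<in> ?S \<longrightarrow> norm (V p) \<le> C0"
    using C0 S by (simp add: AE_restrict_space_iff AE_completion_iff)
  with Vg have "AE p in lborel. p \<in> {0..a} \<times> {0<..<b} \<longrightarrow> W p = c * V p"
  proof eventually_elim
    case (elim p)
    show ?case
    proof
      assume p: "p \<in> {0..a} \<times> {0<..<b}"
      then have "p \<in> ?S" by auto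
      then have "g p = V p" "norm (V p) \<le> \<bar>C0\<bar>" using elim by auto
      then have "norm (c * g p) \<le> C" by (simp add: C_def norm_mult mult_left_mono)
      then show "W p = c * V p" using p \<open>g p = V p\<close> by (auto simp: W_def)
    qed
  qed
  then have "AE x in lborel. AE y in lborel. (x, y) \<in> {0..a} \<times> {0<..<b} \<longrightarrow> W (x, y) = c * V (x, y)"
    unfolding lborel_prod[symmetric] by (rule lborel_pair.AE_pair)
  then have "AE x in lborel. x \<in> {0..a} \<longrightarrow> (AE y in lebesgue. y \<in> {0<..<b} \<longrightarrow> W (x, y) = c * V (x, y))"
    by eventually_elim (auto simp: AE_completion_iff)
  then have "AE x in lebesgue. x \<in> {0..a} \<longrightarrow> (AE y in lebesgue. y \<in> {0<..<b} \<longrightarrow> W (x, y) = c * V (x, y))"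
    by (rule AE_completion)
  moreover have "W (x, y) = 0" if "y \<notin> {0<..<b}" for x y using that by (auto simp: W_def)
  ultimately show ?thesis using fam by blast
qed

section \<open>The Dirac evolution as a Volterra equation\<close>

text \<open>This is the orthogonal projection onto \<open>L2_on S\<close>. Its fixed points are exactly that subspace,
  so membership in the subspace is a linear equation, preserved by Bochner integrals.\<close>

definition restrict_L2 :: "real set \<Rightarrow> L2 \<Rightarrow> L2"
  where "restrict_L2 S = mult_L2 (indicator S)"

lemma multiplier_indicator: "S \<in> sets lebesgue \<Longrightarrow> multiplier (indicator S) 1"
  by unfold_locales (auto simp: indicator_def)

lemma (in multiplier) mult_L2_in_L2_on:
  assumes "\<And>y. y \<notin> S \<Longrightarrow> w y = 0"
  shows "mult_L2 w F \<in> L2_on S"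
  unfolding L2_on_def using rep_mult_L2[of F]
  by (auto elim!: eventually_mono simp: assms)

lemma restrict_L2_in_L2_on: "S \<in> sets lebesgue \<Longrightarrow> restrict_L2 S F \<in> L2_on S"
  unfolding restrict_L2_def by (rule multiplier.mult_L2_in_L2_on[OF multiplier_indicator]) auto

lemma restrict_L2_ident:
  assumes "F \<in> L2_on S"
  shows "restrict_L2 S F = F"
proof -
  have "AE y in lebesgue. rep_L2 F y = indicator S y *s rep_L2 F y"
    using assms unfolding L2_on_def mem_Collect_eq by eventually_elim (auto simp: indicator_def)
  from L2_class_cong_AE(2)[OF square_integrable_rep_L2 this]
  show ?thesis by (simp add: restrict_L2_def mult_L2_def)
qed

lemma scaleC_L2_of_real: "scaleC_L2 (of_real r) F = r *\<^sub>R F"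
proof -
  have "of_real r *s v = r *\<^sub>R v" for v :: "complex^2"
    unfolding vec_eq_iff vector_smult_component vector_scaleR_component by (simp add: scaleR_conv_of_real)
  then show ?thesis
    using L2_class_scaleR[OF square_integrable_rep_L2[of F], of r] by (simp add: scaleC_L2_def)
qed

lemma semigroup_preserves:
  assumes "strongly_continuous_semigroup X T" "s \<ge> 0" "F \<in> X"
  shows "T s F \<in> X"
  using assms unfolding strongly_continuous_semigroup_def bounded_operator_on_def by blast

text \<open>Precomposing with the projection extends the semigroup to all of \<open>L2\<close>. The semigroup law survives
  because \<open>T t\<close> maps into the subspace, where the projection acts as the identity.\<close>

lemma C0_semigroup_extension:
  assumes T: "strongly_continuous_semigroup (L2_on S) T" and S: "S \<in> sets lebesgue"
  shows "C0_semigroup (\<lambda>s F. T s (restrict_L2 S F))"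
proof (rule C0_semigroup.intro)
  note mem = restrict_L2_in_L2_on[OF S]
  note lin_P = multiplier.bounded_linear_mult_L2[OF multiplier_indicator[OF S], folded restrict_L2_def]
  fix s :: real assume s: "s \<ge> 0"
  have Ts: "bounded_operator_on (L2_on S) (T s)"
    using T s by (auto simp: strongly_continuous_semigroup_def)
  then obtain C where C: "\<And>F. F \<in> L2_on S \<Longrightarrow> norm (T s F) \<le> C * norm F"
    unfolding bounded_operator_on_def by blast
  show "bounded_linear (\<lambda>F. T s (restrict_L2 S F))"
  proof (rule bounded_linear_intro)
    fix F G :: L2 and r :: real
    show "T s (restrict_L2 S (F + G)) = T s (restrict_L2 S F) + T s (restrict_L2 S G)"
      using Ts mem lin_P by (simp add: bounded_operator_on_def linear_simps)
    have "T s (scaleC_L2 (of_real r) (restrict_L2 S F)) = scaleC_L2 (of_real r) (T s (restrict_L2 S F))"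
      using Ts mem by (simp add: bounded_operator_on_def)
    then show "T s (restrict_L2 S (r *\<^sub>R F)) = r *\<^sub>R T s (restrict_L2 S F)"
      using lin_P by (simp add: scaleC_L2_of_real linear_simps)
    have "norm (T s (restrict_L2 S F)) \<le> C * norm (restrict_L2 S F)" by (rule C[OF mem])
    also have "\<dots> \<le> \<bar>C\<bar> * (1 * norm F)"
      unfolding restrict_L2_def
      by (intro mult_mono multiplier.norm_mult_L2[OF multiplier_indicator[OF S]]) auto
    finally show "norm (T s (restrict_L2 S F)) \<le> norm F * \<bar>C\<bar>" by (simp add: mult.commute)
  qed
  fix t :: real and F assume t: "t \<ge> 0"
  have "T t (restrict_L2 S F) \<in> L2_on S"
    by (intro semigroup_preserves[OF T t] mem)
  then show "T (s + t) (restrict_L2 S F) = T s (restrict_L2 S (T t (restrict_L2 S F)))"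
    using T s t mem by (simp add: strongly_continuous_semigroup_def restrict_L2_ident)
next
  fix F
  show "((\<lambda>s. T s (restrict_L2 S F)) \<longlongrightarrow> T 0 (restrict_L2 S F)) (at_right 0)"
    using T restrict_L2_in_L2_on[OF S] by (simp add: strongly_continuous_semigroup_def)
qed

locale duhamel = multiplier_family W C + U: C0_semigroup U
  for W :: "real \<times> real \<Rightarrow> complex" and C :: real and U :: "real \<Rightarrow> L2 \<Rightarrow> L2"
begin

definition kernel :: "real \<Rightarrow> real \<Rightarrow> L2 \<Rightarrow> L2"
  where "kernel x s F = U (x - s) (mult_L2 (\<lambda>y. W (s, y)) F)"

text \<open>For measurability along a continuous path, the semigroup is applied to a measurable path of pairs
  (time, field), and joint continuity makes the composition measurable.\<close>

lemma kernel_is_volterra: "\<exists>D. volterra_kernel kernel L D"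
proof -
  obtain M where M: "M > 0" "\<And>s F. s \<in> {0..L} \<Longrightarrow> norm (U s F) \<le> M * norm F"
    using U.locally_bounded[of L] by blast
  have C: "C \<ge> 0" using multiplier.C_nonneg[OF multiplier] .
  \<comment> \<open>\<open>C + 1\<close> rather than \<open>C\<close>, because the constant of a kernel has to be positive\<close>
  have "volterra_kernel kernel L (M * (C + 1))"
  proof (rule volterra_kernel.intro)
    show "M * (C + 1) > 0" using M C by simp
    fix s x :: real and F
    assume sx: "0 \<le> s" "s \<le> x" "x \<le> L"
    show "linear (kernel x s)"
      unfolding kernel_def[abs_def] using sx
      by (intro bounded_linear.linear bounded_linear_compose[OF U.bounded_linear]
          multiplier.bounded_linear_mult_L2[OF multiplier]) auto
    have "norm (kernel x s F) \<le> M * norm (mult_L2 (\<lambda>y. W (s, y)) F)"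
      unfolding kernel_def using sx by (intro M) auto
    also have "\<dots> \<le> M * (C * norm F)"
      using M by (intro mult_left_mono multiplier.norm_mult_L2[OF multiplier]) auto
    also have "\<dots> \<le> M * (C + 1) * norm F"
      using M by (simp add: algebra_simps)
    finally show "norm (kernel x s F) \<le> M * (C + 1) * norm F" .
  next
    fix x :: real and \<psi> :: "real \<Rightarrow> L2"
    assume x: "0 \<le> x" "x \<le> L" and \<psi>: "continuous_on {0..L} \<psi>"
    let ?M = "lebesgue_on {0..x}"
    have id: "(\<lambda>s. s) \<in> borel_measurable ?M"
      using id_borel_measurable_lebesgue_on by (simp add: id_def)
    have "\<psi> \<in> borel_measurable ?M"
      using x by (intro continuous_imp_measurable_on_sets_lebesgue continuous_on_subset[OF \<psi>]) auto
    then have B: "(\<lambda>s. mult_L2 (\<lambda>y. W (s, y)) (\<psi> s)) \<in> borel_measurable ?M"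
      by (rule borel_measurable_mult[OF _ id])
    \<comment> \<open>clamping the time at 0 makes the evaluation map continuous on the whole product\<close>
    have "continuous_on UNIV (\<lambda>p. case (max 0 (fst p), snd p) of (s, F) \<Rightarrow> U s F)"
      by (rule continuous_on_compose2[OF U.jointly_continuous])
        (auto intro!: continuous_intros)
    then have "continuous_on UNIV (\<lambda>p. U (max 0 (fst p)) (snd p))" by simp
    from borel_measurable_continuous_Pair[OF borel_measurable_diff[OF borel_measurable_const id] B this]
    have "(\<lambda>s. U (max 0 (x - s)) (mult_L2 (\<lambda>y. W (s, y)) (\<psi> s))) \<in> borel_measurable ?M" .
    then show "(\<lambda>s. kernel x s (\<psi> s)) \<in> borel_measurable ?M"
      by (subst measurable_cong[where g = "\<lambda>s. U (max 0 (x - s)) (mult_L2 (\<lambda>y. W (s, y)) (\<psi> s))"])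
        (auto simp: kernel_def)
  next
    fix s :: real and F assume "0 \<le> s"
    have "continuous_on {s..L} (\<lambda>x. case (x - s, mult_L2 (\<lambda>y. W (s, y)) F) of (s, F) \<Rightarrow> U s F)"
      by (rule continuous_on_compose2[OF U.jointly_continuous])
        (auto intro!: continuous_intros)
    then show "continuous_on {s..L} (\<lambda>x. kernel x s F)" by (simp add: kernel_def)
  qed
  then show ?thesis by blast
qed

end

text \<open>The values of \<open>V\<close> outside \<open>S\<close> may be arbitrary, even non-measurable: they are multiplied by a field
  that vanishes there almost everywhere.\<close>

lemma potential_op_eq_mult_L2:
  assumes F: "F \<in> L2_on S" and W0: "\<And>y. y \<notin> S \<Longrightarrow> W (x, y) = 0" and W: "multiplier_family W C"
    and V: "AE y in lebesgue. y \<in> S \<longrightarrow> W (x, y) = - \<i> * complex_of_real k * V (x, y)"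
  shows "potential_op k V x F = mult_L2 (\<lambda>y. W (x, y)) F"
proof -
  interpret multiplier "\<lambda>y. W (x, y)" C by (rule multiplier_family.multiplier[OF W])
  have "AE y in lebesgue. y \<notin> S \<longrightarrow> rep_L2 F y = 0" using F by (simp add: L2_on_def)
  with V have "AE y in lebesgue. W (x, y) *s rep_L2 F y = (- \<i> * complex_of_real k * V (x, y)) *s rep_L2 F y"
  proof eventually_elim
    case (elim y)
    then show ?case by (cases "y \<in> S") auto
  qed
  from L2_class_cong_AE(2)[OF square_integrable_mult[OF square_integrable_rep_L2] this]
  show ?thesis by (simp add: potential_op_def mult_L2_def)
qed

text \<open>For a function that is not square-integrable \<open>L2_class\<close> returns 0, which also lies in the subspace; for
  a square-integrable one the support condition decides.\<close>

lemma L2_class_test_function: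
  assumes "test_function S g"
  shows "L2_class g \<in> L2_on S"
proof (cases "square_integrable g")
  case True
  have "g y = 0" if "y \<notin> S" for y
    using assms that closure_subset[of "{y. g y \<noteq> 0}"] by (auto simp: test_function_def)
  then show ?thesis
    using rep_L2_class[OF True] by (auto simp: L2_on_def elim!: eventually_mono)
next
  case False
  then have "L2_class g = L2_class (\<lambda>y. 0)" by (simp add: L2_class_def zero_L2.abs_eq)
  then show ?thesis
    using rep_L2_class[OF square_integrable_0] by (auto simp: L2_on_def elim!: eventually_mono)
qed

section \<open>Existence and uniqueness of the mild solution\<close>

theorem theorem2p1:
  fixes k Lx Ly :: real
    and V :: "real \<times> real \<Rightarrow> complex"
    and g :: "real \<Rightarrow> complex^2"
    and T :: "real \<Rightarrow> L2 \<Rightarrow> L2"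
  assumes "k \<ge> 0" and "Lx > 0" and "Ly > 0"
    and "L_infinity ({0..Lx} \<times> {0..Ly}) V"
    and "test_function {0<..<Ly} g"
    and "semigroup_generated_by (L2_on {0<..<Ly}) (dirac_domain Ly) (dirac_op k Ly) T"
  shows "\<exists>!\<psi>. mild_solution k Lx Ly V T g \<psi>"
proof -
  define S where "S = {0<..<Ly}"
  have S: "S \<in> sets lebesgue" unfolding S_def by (intro sets_completionI_sets) simp
  have T: "strongly_continuous_semigroup (L2_on S) T"
    using assms(6) by (simp add: semigroup_generated_by_def S_def)
  have T_X: "T s F \<in> L2_on S" if "s \<ge> 0" "F \<in> L2_on S" for s F
    using T that by (rule semigroup_preserves)
  define U where "U s F = T s (restrict_L2 S F)" for s F
  have UT: "U s F = T s F" if "F \<in> L2_on S" for s F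
    by (simp add: U_def restrict_L2_ident that)
  interpret U: C0_semigroup U
    unfolding U_def[abs_def] by (rule C0_semigroup_extension[OF T S])
  obtain W C where W: "multiplier_family W C" and W0: "\<And>x y. y \<notin> S \<Longrightarrow> W (x, y) = 0"
    and WV: "AE x in lebesgue. x \<in> {0..Lx} \<longrightarrow>
      (AE y in lebesgue. y \<in> S \<longrightarrow> W (x, y) = - \<i> * complex_of_real k * V (x, y))"
    using L_infinity_borel_version[OF assms(4), of "- \<i> * complex_of_real k"] unfolding S_def by blast
  interpret W: multiplier_family W C by (rule W)
  interpret duhamel W C U ..
  obtain D where "volterra_kernel kernel Lx D" using kernel_is_volterra by blast
  then interpret K: volterra_kernel kernel Lx D .
  have mult_X: "mult_L2 (\<lambda>y. W (s, y)) F \<in> L2_on S" for s F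
    by (rule multiplier.mult_L2_in_L2_on[OF W.multiplier W0])
  define G where "G = L2_class g"
  have G: "G \<in> L2_on S" unfolding G_def S_def by (rule L2_class_test_function[OF assms(5)])
  \<comment> \<open>On paths in the subspace the Duhamel integral is the Volterra integral of the regular kernel: the
    integrands differ at most for the null set of \<open>s\<close> at which the slice of \<open>V\<close> is not represented by \<open>W\<close>.\<close>
  have duhamel_integral:
    "integrable (lebesgue_on {0..x}) (\<lambda>s. T (x - s) (potential_op k V s (\<psi> s))) \<and>
     (LINT s|lebesgue_on {0..x}. T (x - s) (potential_op k V s (\<psi> s))) = K.volterra \<psi> x"
    if x: "x \<in> {0..Lx}" and \<psi>: "continuous_on {0..Lx} \<psi>" and X: "\<And>s. s \<in> {0..Lx} \<Longrightarrow> \<psi> s \<in> L2_on S"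
    for \<psi> x
  proof -
    have ae: "AE s in lebesgue. s \<in> {0..x} \<longrightarrow> kernel x s (\<psi> s) = T (x - s) (potential_op k V s (\<psi> s))"
      using WV
    proof eventually_elim
      case (elim s)
      show ?case
      proof
        assume "s \<in> {0..x}"
        then have s: "s \<in> {0..Lx}" using x by auto
        then have "AE y in lebesgue. y \<in> S \<longrightarrow> W (s, y) = - \<i> * complex_of_real k * V (s, y)"
          using elim by blast
        from potential_op_eq_mult_L2[OF X[OF s] W0 W this]
        show "kernel x s (\<psi> s) = T (x - s) (potential_op k V s (\<psi> s))"
          by (simp add: kernel_def UT mult_X)
      qed
    qed
    have int: "integrable (lebesgue_on {0..x}) (\<lambda>s. kernel x s (\<psi> s))"
      using x by (intro K.integrable_kernel \<psi>) auto
    show ?thesis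
      using integral_lebesgue_on_cong_AE[OF int _ ae] by (simp add: K.volterra_def)
  qed
  have mild_iff: "mild_solution k Lx Ly V T g \<psi> \<longleftrightarrow>
      \<psi> \<in> continuous_maps {0..Lx} (L2_on S) \<and> (\<forall>x\<in>{0..Lx}. \<psi> x = U x G + K.volterra \<psi> x)" for \<psi>
  proof (cases "\<psi> \<in> continuous_maps {0..Lx} (L2_on S)")
    case True
    then have "continuous_on {0..Lx} \<psi>" "\<And>s. s \<in> {0..Lx} \<Longrightarrow> \<psi> s \<in> L2_on S"
      by (auto simp: continuous_maps_def)
    from duhamel_integral[OF _ this] True show ?thesis
      unfolding mild_solution_def S_def[symmetric] G_def[symmetric] by (simp add: UT G)
  qed (simp add: mild_solution_def S_def)
  have U_cont: "continuous_on {0..Lx} (\<lambda>x. U x G)"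
  proof -
    have "continuous_on {0..Lx} (\<lambda>x. case (x, G) of (s, F) \<Rightarrow> U s F)"
      by (rule continuous_on_compose2[OF U.jointly_continuous]) (auto intro!: continuous_intros)
    then show ?thesis by simp
  qed
  obtain \<psi> where \<psi>: "continuous_on {0..Lx} \<psi>" "\<And>x. x \<in> {0..Lx} \<Longrightarrow> \<psi> x = U x G + K.volterra \<psi> x"
    using K.volterra_solvable[OF U_cont] by blast
  \<comment> \<open>The equation was solved in the whole space; the solution takes values in the subspace because
    both terms on the right are fixed by the projection.\<close>
  have \<psi>_X: "\<psi> x \<in> L2_on S" if x: "x \<in> {0..Lx}" for x
  proof -
    note lin_P = multiplier.bounded_linear_mult_L2[OF multiplier_indicator[OF S], folded restrict_L2_def]
    have "restrict_L2 S (K.volterra \<psi> x) = (LINT s|lebesgue_on {0..x}. restrict_L2 S (kernel x s (\<psi> s)))"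
      unfolding K.volterra_def using x
      by (intro integral_bounded_linear[symmetric] lin_P K.integrable_kernel \<psi>) auto
    also have "\<dots> = K.volterra \<psi> x"
      unfolding K.volterra_def
      by (intro Bochner_Integration.integral_cong refl)
        (auto simp: kernel_def UT mult_X intro!: restrict_L2_ident T_X)
    finally have "restrict_L2 S (\<psi> x) = \<psi> x"
      unfolding \<psi>(2)[OF x] using x lin_P by (simp add: linear_simps UT G T_X restrict_L2_ident)
    then show ?thesis using restrict_L2_in_L2_on[OF S, of "\<psi> x"] by simp
  qed
  \<comment> \<open>Mild solutions are undefined outside the interval, which makes uniqueness literal equality.\<close>
  define \<psi>' where "\<psi>' = restrict \<psi> {0..Lx}"
  have "K.volterra \<psi>' x = K.volterra \<psi> x" if "x \<in> {0..Lx}" for x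
    unfolding K.volterra_def using that
    by (intro Bochner_Integration.integral_cong refl) (auto simp: \<psi>'_def)
  moreover have "continuous_on {0..Lx} \<psi>'"
    using \<psi>(1) by (subst continuous_on_cong[OF refl, of _ _ \<psi>]) (auto simp: \<psi>'_def)
  ultimately have ex: "mild_solution k Lx Ly V T g \<psi>'"
    using \<psi>(2) \<psi>_X unfolding mild_iff continuous_maps_def by (auto simp: \<psi>'_def)
  have "\<eta> = \<psi>'" if "mild_solution k Lx Ly V T g \<eta>" for \<eta>
  proof (rule extensionalityI)
    show "\<eta> \<in> extensional {0..Lx}" "\<psi>' \<in> extensional {0..Lx}"
      using that ex by (auto simp: mild_iff continuous_maps_def)
    show "\<eta> x = \<psi>' x" if "x \<in> {0..Lx}" for x
      using \<open>mild_solution k Lx Ly V T g \<eta>\<close> ex that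
      by (intro K.volterra_unique[of \<eta> \<psi>' "\<lambda>x. U x G"]) (auto simp: mild_iff continuous_maps_def)
  qed
  with ex show ?thesis by blast
qed

end
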